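(* Let $q>2$. For each $E>0$ and $L>0$ there are at most finitely many knot types (ambient isotopy classes of simple closed curves in $\mathbb{R}^3$) which have a representative $\gamma$, a closed rectifiable simple curve in $\mathbb{R}^3$, such that $$\mathcal{E}_q(\gamma)<E\qquad\text{and}\qquad\mathscr{H}^1(\gamma)=L.$$
   Context: $\mathscr{H}^1$ is one-dimensional Hausdorff measure, so $\mathscr{H}^1(\gamma)$ is the length of the simple curve $\gamma$. $S_L\cong\mathbb{R}/(L\mathbb{Z})$ is the circle of perimeter $L$. A closed rectifiable simple curve $\gamma\subset\mathbb{R}^3$ of length $L$ has an injective arclength parametrization $\Gamma:S_L\to\mathbb{R}^3$, i.e. an injective Lipschitz map with $\Gamma(S_L)=\gamma$ and $|\Gamma'|=1$ a.e. For $s\in S_L$ and almost every $t\in S_L$ (those where $\Gamma'(t)$ exists with $|\Gamma'(t)|=1$) let $\ell(t)=\{\Gamma(t)+\mu\Gamma'(t):\mu\in\mathbb{R}\}$ be the tangent line, and define the tangent-point radius $$r(\Gamma(t),\Gamma(s))=\frac{|\Gamma(t)-\Gamma(s)|^2}{2\operatorname{dist}(\ell(t),\Gamma(s))}\in[0,\infty],$$ where $r$ is set to be $0$ if $\Gamma(t)=\Gamma(s)$, and $r=\infty$ (i.e. $1/r=0$) if $\Gamma(s)-\Gamma(t)\neq0$ is parallel to $\Gamma'(t)$. The tangent-point energy is $$\mathcal{E}_q(\gamma)=\mathcal{E}_q(\Gamma)=\int_0^L\int_0^L\frac{ds\,dt}{r(\Gamma(t),\Gamma(s))^q}.$$ 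*)

theory Defs
  imports "HOL-Analysis.Analysis"
begin

definition simple_closed_curve :: "(real^3) set \<Rightarrow> bool" where
  "simple_closed_curve \<gamma> \<longleftrightarrow>
     (\<exists>g. simple_path g \<and> pathfinish g = pathstart g \<and> path_image g = \<gamma>)"

text \<open>Rectifiability means that the lengths of the inscribed polygons are bounded.\<close>

definition rectifiable_path :: "(real \<Rightarrow> 'a::metric_space) \<Rightarrow> bool" where
  "rectifiable_path g \<longleftrightarrow> path g \<and>
     (\<exists>B. \<forall>ts. sorted ts \<and> set ts \<subseteq> {0..1} \<longrightarrow>
        (\<Sum>i<length ts - 1. dist (g (ts ! i)) (g (ts ! Suc i))) \<le> B)"

definition rectifiable_simple_closed_curve :: "(real^3) set \<Rightarrow> bool" where
  "rectifiable_simple_closed_curve \<gamma> \<longleftrightarrow>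
     (\<exists>g. simple_path g \<and> rectifiable_path g \<and> pathfinish g = pathstart g \<and> path_image g = \<gamma>)"

text \<open>
  An ambient isotopy is a homotopy of self-maps of the whole space that starts at the identity and
  all of whose stages are homeomorphisms. Curves are sets, so knots are unoriented; they are not
  assumed to be tame.
\<close>

definition ambient_isotopic :: "(real^3) set \<Rightarrow> (real^3) set \<Rightarrow> bool" where
  "ambient_isotopic \<gamma> \<gamma>' \<longleftrightarrow>
     (\<exists>h. homotopic_with_canon (\<lambda>f. \<exists>g. homeomorphism UNIV UNIV f g) UNIV UNIV id h \<and> h ` \<gamma> = \<gamma>')"

definition knot_rel :: "((real^3) set \<times> (real^3) set) set" where
  "knot_rel = {(\<gamma>, \<gamma>'). simple_closed_curve \<gamma> \<and> simple_closed_curve \<gamma>' \<and> ambient_isotopic \<gamma> \<gamma>'}"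

definition knot_types :: "(real^3) set set set" where
  "knot_types = {\<gamma>. simple_closed_curve \<gamma>} // knot_rel"

lemma homeo_comp:
  fixes f f' :: "real^3 \<Rightarrow> real^3"
  assumes "\<exists>g. homeomorphism UNIV UNIV f g" "\<exists>g. homeomorphism UNIV UNIV f' g"
  shows "\<exists>g. homeomorphism UNIV UNIV (f \<circ> f') g"
  using assms by (meson homeomorphism_compose)

lemma ambient_isotopic_refl: "ambient_isotopic \<gamma> \<gamma>"
  unfolding ambient_isotopic_def
proof (intro exI conjI)
  show "homotopic_with_canon (\<lambda>f. \<exists>g. homeomorphism UNIV UNIV f g) UNIV UNIV id (id :: real^3 \<Rightarrow> real^3)"
    by (simp add: id_def) (rule exI, rule homeomorphism_ident)
qed simp

lemma ambient_isotopic_sym: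
  assumes "ambient_isotopic \<gamma> \<gamma>'"
  shows "ambient_isotopic \<gamma>' \<gamma>"
proof -
  let ?P = "\<lambda>f :: real^3 \<Rightarrow> real^3. \<exists>g. homeomorphism UNIV UNIV f g"
  obtain h where h: "homotopic_with_canon ?P UNIV UNIV id h" and im: "h ` \<gamma> = \<gamma>'"
    using assms by (auto simp: ambient_isotopic_def)
  obtain k where k: "homeomorphism UNIV UNIV h k"
    using homotopic_with_imp_property[OF h] by auto
  have Pk: "?P k" using k homeomorphism_symD by blast
  have hk: "h \<circ> k = id" "\<And>x. k (h x) = x"
    using k by (auto simp: homeomorphism_def)
  have "homotopic_with_canon ?P UNIV UNIV (id \<circ> k) (h \<circ> k)"
    by (rule homotopic_with_compose_continuous_map_right[OF h])
       (use k Pk homeo_comp in \<open>auto simp: homeomorphism_def\<close>)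
  then have "homotopic_with_canon ?P UNIV UNIV id k"
    by (simp add: hk homotopic_with_sym)
  moreover have "k ` \<gamma>' = \<gamma>"
    unfolding im[symmetric] by (simp add: image_image hk)
  ultimately show ?thesis by (auto simp: ambient_isotopic_def)
qed

lemma ambient_isotopic_trans:
  assumes "ambient_isotopic \<gamma> \<gamma>'" "ambient_isotopic \<gamma>' \<gamma>''"
  shows "ambient_isotopic \<gamma> \<gamma>''"
proof -
  let ?P = "\<lambda>f :: real^3 \<Rightarrow> real^3. \<exists>g. homeomorphism UNIV UNIV f g"
  obtain h where h: "homotopic_with_canon ?P UNIV UNIV id h" and im: "h ` \<gamma> = \<gamma>'"
    using assms by (auto simp: ambient_isotopic_def)
  obtain k where k: "homotopic_with_canon ?P UNIV UNIV id k" and imk: "k ` \<gamma>' = \<gamma>''"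
    using assms by (auto simp: ambient_isotopic_def)
  have Ph: "?P h" using homotopic_with_imp_property[OF h] by auto
  have "homotopic_with_canon ?P UNIV UNIV (id \<circ> h) (k \<circ> h)"
    by (rule homotopic_with_compose_continuous_map_right[OF k])
       (use Ph homeo_comp in \<open>auto simp: homeomorphism_def\<close>)
  then have "homotopic_with_canon ?P UNIV UNIV id (k \<circ> h)"
    using h homotopic_with_trans by fastforce
  then show ?thesis
    unfolding ambient_isotopic_def using im imk by (metis image_comp)
qed

lemma equiv_knot_rel: "equiv {\<gamma>. simple_closed_curve \<gamma>} knot_rel"
  by (rule equivI)
     (auto simp: knot_rel_def refl_on_def sym_def trans_def
        intro: ambient_isotopic_refl ambient_isotopic_sym ambient_isotopic_trans)

text \<open>
  One-dimensional Hausdorff (outer) measure: \<open>\<H>\<^sub>\<delta>(A)\<close> is the infimum of the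
  total diameter of countable covers of \<open>A\<close> by sets of diameter at most \<open>\<delta>\<close>, and the measure is
  the supremum over \<open>\<delta> > 0\<close>. The library diameter is a junk value for unbounded sets, hence the
  boundedness condition; empty members allow finite covers.
\<close>

definition hausdorff1_content :: "real \<Rightarrow> 'a::metric_space set \<Rightarrow> ennreal" where
  "hausdorff1_content \<delta> A =
     (INF U \<in> {U :: nat \<Rightarrow> 'a set. A \<subseteq> (\<Union>i. U i) \<and> (\<forall>i. bounded (U i) \<and> diameter (U i) \<le> \<delta>)}.
        \<Sum>i. ennreal (diameter (U i)))"

definition hausdorff1 :: "'a::metric_space set \<Rightarrow> ennreal" where
  "hausdorff1 A = (SUP \<delta> \<in> {0<..}. hausdorff1_content \<delta> A)"

text \<open>
  Maps on the circle \<open>\<real>/(L\<int>)\<close> are represented by their \<open>L\<close>-periodic lifts to the real line.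
  A lift is Lipschitz on the line iff the map is Lipschitz on the circle.
\<close>

definition arclength_parametrization :: "real \<Rightarrow> (real \<Rightarrow> real^3) \<Rightarrow> (real^3) set \<Rightarrow> bool" where
  "arclength_parametrization L \<Gamma> \<gamma> \<longleftrightarrow>
     (\<forall>t. \<Gamma> (t + L) = \<Gamma> t) \<and>
     inj_on \<Gamma> {0..<L} \<and>
     \<Gamma> ` {0..<L} = \<gamma> \<and>
     (\<exists>C. C-lipschitz_on UNIV \<Gamma>) \<and>
     (AE t in lborel. \<exists>v. (\<Gamma> has_vector_derivative v) (at t) \<and> norm v = 1)"

definition tangent_line :: "(real \<Rightarrow> real^3) \<Rightarrow> real \<Rightarrow> (real^3) set" where
  "tangent_line \<Gamma> t = {\<Gamma> t + \<mu> *\<^sub>R vector_derivative \<Gamma> (at t) | \<mu>. True}"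

text \<open>
  The second case is that of \<open>\<Gamma> s - \<Gamma> t \<noteq> 0\<close> parallel to the unit vector \<open>\<Gamma>' t\<close>. The value is
  meaningless for the null set of \<open>t\<close> where \<open>\<Gamma>\<close> has no unit derivative.
\<close>

definition tangent_point_radius :: "(real \<Rightarrow> real^3) \<Rightarrow> real \<Rightarrow> real \<Rightarrow> ennreal" where
  "tangent_point_radius \<Gamma> t s =
     (if \<Gamma> t = \<Gamma> s then 0
      else if \<Gamma> s \<in> tangent_line \<Gamma> t then \<infinity>
      else ennreal ((norm (\<Gamma> t - \<Gamma> s))\<^sup>2 / (2 * infdist (\<Gamma> s) (tangent_line \<Gamma> t))))"

text \<open>Real powers on \<open>[0,\<infinity>]\<close>, intended for positive exponents only.\<close>

definition ennreal_powr :: "ennreal \<Rightarrow> real \<Rightarrow> ennreal" where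
  "ennreal_powr x q = (if x = \<infinity> then \<infinity> else ennreal (enn2real x powr q))"

text \<open>Division on \<open>ennreal\<close> satisfies \<open>1 / 0 = \<infinity>\<close> and \<open>1 / \<infinity> = 0\<close>.\<close>

definition tangent_point_energy :: "real \<Rightarrow> real \<Rightarrow> (real \<Rightarrow> real^3) \<Rightarrow> ennreal" where
  "tangent_point_energy q L \<Gamma> =
     (\<integral>\<^sup>+t\<in>{0..L}. (\<integral>\<^sup>+s\<in>{0..L}. 1 / ennreal_powr (tangent_point_radius \<Gamma> t s) q \<partial>lborel) \<partial>lborel)"

end

theory Submission
  imports Defs
begin

text \<open>
  For \<open>q > 2\<close> the energy punishes every geometric irregularity more, the smaller its scale is.
  Take two points of the curve at distance \<open>d\<close>. If on a parameter set of length \<open>\<epsilon> d\<close> near one of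
  them the tangents deviate by more than \<open>\<epsilon>\<close> from the direction of the chord, then the
  tangent-point radius is at most of order \<open>d / \<epsilon>\<close> on a set of pairs of measure of order
  \<open>(\<epsilon> d)\<^sup>2\<close>, which costs energy of order \<open>\<epsilon> powr (q + 2) * d powr (2 - q)\<close>. So the energy bound
  forces \<open>\<epsilon> \<le> C d\<^sup>\<alpha>\<close> with \<open>\<alpha> = (q - 2) / (q + 2)\<close>. This is \<open>aligned_loop_if_energy_le\<close>: chords
  align most of the tangents near their end points, however far the end points are from each other
  along the curve. All further geometry of the curve is drawn from this alignment, with constants
  that depend on \<open>L\<close>, \<open>C\<close> and \<open>\<alpha>\<close> only.

  Short arcs do not fold (\<open>chord_arc\<close>). Consider the projection of an arc to the line of its
  chord. If two points of the arc have the same projection, then their connecting chord is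
  perpendicular to the chord of the arc, and by alignment so are most of the tangents nearby; but
  alignment with the chord of the arc leaves room for very few such tangents. So the projection is
  injective up to a small set, and the chord of the arc cannot have between one half and three
  quarters of the length of the arc. The ratio of chord to arc depends continuously on the arc and
  tends to 1 at any point with a unit derivative, hence it never drops below three quarters.

  Tangents are equicontinuous (\<open>tang_modulus\<close>), because chords over an interval and over half of
  it are aligned with common tangents, and the resulting errors form a geometric series over the
  dyadic scales. Distant arcs do not approach each other (\<open>far_apart\<close>), because at a pair of
  closest points the tangents would be perpendicular to the chord instead of parallel. Together
  these facts give a bi-Lipschitz bound that is uniform over all curves in question.

  Finally, cut the parameter interval into short pieces and record, for each piece, a nearby
  element of a finite net of the unit sphere for the tangent. There are finitely many such codes.
  For two curves with the same code, the difference of the parametrizations is Lipschitz with a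
  small constant, so the displacement that takes one curve to the other is Lipschitz on the first
  curve with a small constant, by the bi-Lipschitz bound. It extends to a contraction \<open>\<phi>\<close> of
  space, and \<open>x + t \<phi>(x)\<close> is an ambient isotopy (\<open>ambient_isotopic_lipschitz_displacement\<close>). Only
  differences of values enter, so the positions of the curves in space do not matter. Hence the
  code determines the knot type.
\<close>

section \<open>Ambient isotopies from contractive displacements\<close>

text \<open>
  A preimage of \<open>y\<close> is a fixed point of the contraction \<open>\<lambda>x. y - \<phi> x\<close>, and \<open>\<phi>\<close> shrinks distances
  too strongly to cancel the identity, which makes the inverse Lipschitz.
\<close>

lemma homeomorphism_id_plus_contraction:
  fixes \<phi> :: "'a::euclidean_space \<Rightarrow> 'a"
  assumes \<phi>: "c-lipschitz_on UNIV \<phi>" and "c < 1"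
  shows "\<exists>g. homeomorphism UNIV UNIV (\<lambda>x. x + \<phi> x) g"
proof -
  let ?F = "\<lambda>x. x + \<phi> x"
  have lip: "dist (\<phi> x) (\<phi> y) \<le> c * dist x y" for x y
    using lipschitz_onD[OF \<phi>] by simp
  have c0: "0 \<le> c" using lipschitz_on_nonneg[OF \<phi>] .
  have expand: "(1 - c) * dist x y \<le> dist (?F x) (?F y)" for x y
    using norm_triangle_ineq4[of "?F x - ?F y" "\<phi> x - \<phi> y"] lip[of x y]
    by (simp add: dist_norm algebra_simps)
  have "\<exists>!x. y - \<phi> x = x" for y
    using lip \<open>c < 1\<close> c0 by (intro banach_fix_type[of c]) (auto simp: dist_norm norm_minus_commute)
  moreover have "y - \<phi> x = x \<longleftrightarrow> ?F x = y" for x y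
    by (auto simp: algebra_simps)
  ultimately have bij: "bij ?F" by (simp add: bij_iff)
  have right_inv: "inv ?F z + \<phi> (inv ?F z) = z" for z
    using surj_f_inv_f[OF bij_is_surj[OF bij], of z] .
  have "(1 / (1 - c))-lipschitz_on UNIV (inv ?F)"
  proof (rule lipschitz_onI)
    fix x y :: 'a
    have "(1 - c) * dist (inv ?F x) (inv ?F y) \<le> dist x y"
      using expand[of "inv ?F x" "inv ?F y"] unfolding right_inv .
    then show "dist (inv ?F x) (inv ?F y) \<le> 1 / (1 - c) * dist x y"
      using \<open>c < 1\<close> by (simp add: field_simps)
  qed (use \<open>c < 1\<close> in simp)
  then have "continuous_on UNIV (inv ?F)"
    by (rule lipschitz_on_continuous_on)
  moreover have "continuous_on UNIV ?F"
    using lipschitz_on_continuous_on[OF \<phi>] by (intro continuous_intros)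
  ultimately have "homeomorphism UNIV UNIV ?F (inv ?F)"
    using bij_is_surj[OF bij] bij_is_surj[OF bij_imp_bij_inv[OF bij]]
      inv_f_f[OF bij_is_inj[OF bij]] right_inv
    by (simp add: homeomorphism_def)
  then show ?thesis by blast
qed

text \<open>
  The isotopy moves every point along a straight segment; each stage is again the identity plus a
  contraction.
\<close>

lemma ambient_isotopic_contractive_displacement:
  fixes \<phi> :: "real^3 \<Rightarrow> real^3"
  assumes \<phi>: "c-lipschitz_on UNIV \<phi>" and "c < 1"
  shows "ambient_isotopic \<gamma> ((\<lambda>x. x + \<phi> x) ` \<gamma>)"
proof -
  have c0: "0 \<le> c" using lipschitz_on_nonneg[OF \<phi>] .
  let ?H = "\<lambda>z :: real \<times> (real^3). snd z + fst z *\<^sub>R \<phi> (snd z)"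
  have cont: "continuous_on ({0..1} \<times> UNIV) ?H"
  proof -
    have "continuous_on ({0..1} \<times> UNIV) (\<lambda>z :: real \<times> (real^3). \<phi> (snd z))"
      by (rule continuous_on_compose2[OF lipschitz_on_continuous_on[OF \<phi>]])
         (auto intro: continuous_intros)
    then show ?thesis by (intro continuous_intros)
  qed
  have homeo: "\<exists>g. homeomorphism UNIV UNIV (\<lambda>x. x + t *\<^sub>R \<phi> x) g" if "t \<in> {0..1}" for t :: real
  proof (rule homeomorphism_id_plus_contraction)
    show "(t * c)-lipschitz_on UNIV (\<lambda>x. t *\<^sub>R \<phi> x)"
      using lipschitz_on_cmult[OF \<phi>, of t] that by simp
    show "t * c < 1" using that \<open>c < 1\<close> c0
      by (metis atLeastAtMost_iff le_less_trans mult_left_le_one_le)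
  qed
  have "continuous_map (prod_topology (top_of_set {0..1}) (top_of_set UNIV)) (top_of_set UNIV) ?H"
    unfolding prod_topology_subtopology_eu using cont by (simp only: continuous_map_subtopology_eu) simp
  then have "homotopic_with_canon (\<lambda>f. \<exists>g. homeomorphism UNIV UNIV f g) UNIV UNIV id (\<lambda>x. x + \<phi> x)"
    unfolding homotopic_with_def using homeo by (intro exI[of _ ?H] conjI) simp_all
  then show ?thesis unfolding ambient_isotopic_def by blast
qed

text \<open>
  McShane's extension: the largest function with the given Lipschitz constant and the given
  values.
\<close>

lemma lipschitz_extension_real:
  fixes f :: "'a::metric_space \<Rightarrow> real"
  assumes f: "c-lipschitz_on A f"
  shows "\<exists>g. c-lipschitz_on UNIV g \<and> (\<forall>x\<in>A. g x = f x)"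
proof (cases "A = {}")
  case True
  have "c-lipschitz_on UNIV (\<lambda>x. 0)"
    using lipschitz_on_nonneg[OF f] by (auto intro!: lipschitz_onI)
  then show ?thesis using True by blast
next
  case False
  then obtain a0 where a0: "a0 \<in> A" by blast
  have c0: "0 \<le> c" using lipschitz_on_nonneg[OF f] .
  define g where "g x = (INF a\<in>A. f a + c * dist x a)" for x
  have lip: "\<bar>f a - f b\<bar> \<le> c * dist a b" if "a \<in> A" "b \<in> A" for a b
    using lipschitz_onD[OF f that] by (simp add: dist_real_def)
  have bdd: "bdd_below ((\<lambda>a. f a + c * dist x a) ` A)" for x
  proof (rule bdd_belowI2)
    fix a assume "a \<in> A"
    have "f a0 - f a \<le> c * dist a0 a" using lip[OF a0 \<open>a \<in> A\<close>] by linarith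
    also have "\<dots> \<le> c * (dist x a0 + dist x a)"
      using c0 by (intro mult_left_mono) (metis dist_commute dist_triangle, simp)
    finally show "f a0 - c * dist x a0 \<le> f a + c * dist x a" by (simp add: algebra_simps)
  qed
  have half: "g x \<le> g y + c * dist x y" for x y
  proof -
    have "g x - c * dist x y \<le> g y"
      unfolding g_def[of y]
    proof (rule cINF_greatest[OF False])
      fix a assume "a \<in> A"
      have "g x \<le> f a + c * dist x a"
        unfolding g_def by (rule cINF_lower[OF bdd \<open>a \<in> A\<close>])
      also have "\<dots> \<le> f a + c * (dist x y + dist y a)"
        using c0 by (intro add_left_mono mult_left_mono dist_triangle)
      finally show "g x - c * dist x y \<le> f a + c * dist y a" by (simp add: algebra_simps)
    qed
    then show ?thesis by linarith
  qed
  show ?thesis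
  proof (intro exI[of _ g] conjI ballI)
    show "c-lipschitz_on UNIV g"
    proof (rule lipschitz_onI)
      fix x y :: 'a
      show "dist (g x) (g y) \<le> c * dist x y"
        using half[of x y] half[of y x] by (simp add: dist_real_def dist_commute)
    qed (rule c0)
  next
    fix x assume x: "x \<in> A"
    have "g x \<le> f x + c * dist x x"
      unfolding g_def by (rule cINF_lower[OF bdd x])
    moreover have "f x \<le> g x"
      unfolding g_def
    proof (rule cINF_greatest[OF False])
      fix a assume "a \<in> A"
      show "f x \<le> f a + c * dist x a" using lip[OF x \<open>a \<in> A\<close>] by linarith
    qed
    ultimately show "g x = f x" by simp
  qed
qed

text \<open>
  Extending the coordinates separately costs a factor that depends on the dimension only.
\<close>

lemma lipschitz_extension_vec:
  fixes f :: "'a::metric_space \<Rightarrow> real^'n"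
  assumes f: "c-lipschitz_on A f"
  shows "\<exists>g. (real CARD('n) * c)-lipschitz_on UNIV g \<and> (\<forall>x\<in>A. g x = f x)"
proof -
  have c0: "0 \<le> c" using lipschitz_on_nonneg[OF f] .
  have "\<exists>g. c-lipschitz_on UNIV g \<and> (\<forall>x\<in>A. g x = f x $ i)" for i
  proof -
    have "c-lipschitz_on A (\<lambda>x. f x $ i)"
    proof (rule lipschitz_onI[OF _ c0])
      fix x y assume "x \<in> A" "y \<in> A"
      then show "dist (f x $ i) (f y $ i) \<le> c * dist x y"
        using lipschitz_onD[OF f, of x y] dist_vec_nth_le[of "f x" i "f y"] by linarith
    qed
    from lipschitz_extension_real[OF this] show ?thesis .
  qed
  then obtain g where g: "\<And>i. c-lipschitz_on UNIV (g i)" "\<And>i x. x \<in> A \<Longrightarrow> g i x = f x $ i"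
    by metis
  show ?thesis
  proof (intro exI[of _ "\<lambda>x. \<chi> i. g i x"] conjI ballI)
    show "(real CARD('n) * c)-lipschitz_on UNIV (\<lambda>x. \<chi> i. g i x)"
    proof (rule lipschitz_onI)
      fix x y :: 'a
      have "dist (\<chi> i. g i x) (\<chi> i. g i y) \<le> (\<Sum>i\<in>UNIV. \<bar>g i x - g i y\<bar>)"
        unfolding dist_norm using norm_le_l1_cart[of "(\<chi> i. g i x) - (\<chi> i. g i y)"] by simp
      also have "\<dots> \<le> (\<Sum>i\<in>(UNIV::'n set). c * dist x y)"
        using lipschitz_onD[OF g(1)] by (intro sum_mono) (auto simp: dist_real_def)
      finally show "dist (\<chi> i. g i x) (\<chi> i. g i y) \<le> real CARD('n) * c * dist x y" by simp
    qed (use c0 in simp)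
  qed (use g(2) in \<open>simp add: vec_eq_iff\<close>)
qed

lemma ambient_isotopic_lipschitz_displacement:
  fixes f :: "real^3 \<Rightarrow> real^3"
  assumes "c-lipschitz_on \<gamma> (\<lambda>x. f x - x)" and "c < 1 / 3"
  shows "ambient_isotopic \<gamma> (f ` \<gamma>)"
proof -
  obtain \<phi> where \<phi>: "(real CARD(3) * c)-lipschitz_on UNIV \<phi>" "\<And>x. x \<in> \<gamma> \<Longrightarrow> \<phi> x = f x - x"
    using lipschitz_extension_vec[OF assms(1)] by auto
  have "f ` \<gamma> = (\<lambda>x. x + \<phi> x) ` \<gamma>"
    using \<phi>(2) by (intro image_cong) auto
  then show ?thesis
    using ambient_isotopic_contractive_displacement[OF \<phi>(1)] assms(2) by simp
qed

section \<open>Increments of Lipschitz functions\<close>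

text \<open>
  The fundamental theorem of calculus for Lipschitz functions: the difference quotients are
  dominated by the Lipschitz constant, and their integrals are themselves difference quotients of
  an antiderivative of \<open>f\<close> at the two end points.
\<close>

lemma lipschitz_integral_derivative:
  fixes f :: "real \<Rightarrow> real"
  assumes f: "C-lipschitz_on UNIV f" and "a \<le> b"
    and diff: "AE x in lborel. (f has_real_derivative D x) (at x)"
    and D: "D \<in> borel_measurable borel"
  shows "integrable lborel (\<lambda>x. indicator {a..b} x * D x)"
    and "(\<integral>x. indicator {a..b} x * D x \<partial>lborel) = f b - f a"
proof -
  let ?h = "\<lambda>n :: nat. 1 / (real n + 1)"
  let ?q = "\<lambda>n x. (f (x + ?h n) - f x) / ?h n"
  have h0: "?h \<longlonglongrightarrow> 0"
    using LIMSEQ_inverse_real_of_nat by (simp add: inverse_eq_divide add.commute)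
  have contf: "continuous_on UNIV f" using lipschitz_on_continuous_on[OF f] .
  have [measurable]: "f \<in> borel_measurable borel"
    using contf by (rule borel_measurable_continuous_onI)
  note D[measurable]
  have bound: "\<bar>?q n x\<bar> \<le> C" for n x
  proof -
    have "\<bar>f (x + ?h n) - f x\<bar> \<le> C * ?h n"
      using lipschitz_onD[OF f, of "x + ?h n" x] by (simp add: dist_real_def)
    then have "\<bar>f (x + ?h n) - f x\<bar> / ?h n \<le> C"
      by (subst pos_divide_le_eq) auto
    then show ?thesis by (simp add: abs_divide abs_mult)
  qed
  have quot: "(\<lambda>n. (F (x + ?h n) - F x) / ?h n) \<longlonglongrightarrow> d"
    if "(F has_real_derivative d) (at x)" for F d x
  proof -
    have "filterlim ?h (at 0) sequentially"
      using h0 by (auto simp: filterlim_at intro!: always_eventually)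
    with that show ?thesis
      unfolding DERIV_def by (rule filterlim_compose)
  qed
  obtain F where F0: "\<And>x. x \<in> {a-1..b+2} \<Longrightarrow> (F has_vector_derivative f x) (at x within {a-1..b+2})"
    using antiderivative_continuous[of "a-1" "b+2" f] contf continuous_on_subset by blast
  have F: "(F has_real_derivative f x) (at x)" if "x \<in> {a..b+1}" for x
  proof -
    have "at x within {a-1..b+2} = at x"
      using that by (intro at_within_interior) auto
    then show ?thesis
      using F0[of x] that by (simp add: has_real_derivative_iff_has_vector_derivative)
  qed
  have int_q: "(\<integral>x. indicator {a..b} x * ?q n x \<partial>lborel)
      = (F (b + ?h n) - F b) / ?h n - (F (a + ?h n) - F a) / ?h n" for n
  proof -
    have hn: "0 < ?h n" "?h n \<le> 1" by auto
    have "((\<lambda>x. (F (x + ?h n) - F x) / ?h n) has_real_derivative ?q n x) (at x within {a..b})"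
      if "a \<le> x" "x \<le> b" for x
    proof -
      have "((\<lambda>y. F (y + ?h n)) has_real_derivative f (x + ?h n)) (at x)"
        using F[of "x + ?h n"] that hn by (simp add: DERIV_shift)
      moreover have "(F has_real_derivative f x) (at x)"
        using F[of x] that by simp
      ultimately show ?thesis
        using DERIV_cdivide[OF DERIV_diff] by (blast intro: has_field_derivative_at_within)
    qed
    then have "(\<integral>x. indicator {a..b} x *\<^sub>R ?q n x \<partial>lborel)
      = (F (b + ?h n) - F b) / ?h n - (F (a + ?h n) - F a) / ?h n"
      using \<open>a \<le> b\<close> contf
      by (intro integral_FTC_Icc[where f = "?q n"])
         (auto simp: has_real_derivative_iff_has_vector_derivative
            intro!: continuous_intros continuous_on_compose2[OF contf])
    then show ?thesis by simp
  qed
  have lim: "AE x in lborel. (\<lambda>n. indicator {a..b} x * ?q n x) \<longlonglongrightarrow> indicator {a..b} x * D x"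
    using diff by eventually_elim (rule tendsto_mult[OF tendsto_const quot])
  have dom: "AE x in lborel. norm (indicator {a..b} x * ?q n x) \<le> indicator {a..b} x * C" for n
    using bound[of _ n] by (auto simp: indicator_def)
  have C: "integrable lborel (\<lambda>x. indicator {a..b} x * C :: real)"
    by (intro integrable_mult_left integrable_real_indicator) (auto simp: emeasure_lborel_Icc_eq)
  have meas: "(\<lambda>x. indicator {a..b} x * ?q n x) \<in> borel_measurable lborel"
    "(\<lambda>x. indicator {a..b} x * D x) \<in> borel_measurable lborel" for n
    by measurable
  note integrable_dominated_convergence[OF meas(2) meas(1) C lim dom]
  moreover note integral_dominated_convergence[OF meas(2) meas(1) C lim dom]
  moreover have "(\<lambda>n. \<integral>x. indicator {a..b} x * ?q n x \<partial>lborel) \<longlonglongrightarrow> f b - f a"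
    unfolding int_q using \<open>a \<le> b\<close> by (intro tendsto_diff quot F) auto
  ultimately show "integrable lborel (\<lambda>x. indicator {a..b} x * D x)"
    "(\<integral>x. indicator {a..b} x * D x \<partial>lborel) = f b - f a"
    using LIMSEQ_unique by auto
qed

text \<open>
  The form in which the integral of the derivative is used: one bound on a large good set, a crude
  bound on the rest of the interval.
\<close>

lemma lipschitz_increment_le:
  fixes f :: "real \<Rightarrow> real"
  assumes f: "C-lipschitz_on UNIV f" and "a \<le> b"
    and diff: "AE x in lborel. (f has_real_derivative D x) (at x)"
    and D: "D \<in> borel_measurable borel"
    and A: "A \<in> sets borel" "A \<subseteq> {a..b}"
    and p: "AE x in lborel. x \<in> A \<longrightarrow> D x \<le> p"
    and q: "AE x in lborel. x \<in> {a..b} - A \<longrightarrow> D x \<le> q"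
  shows "f b - f a \<le> p * measure lborel A + q * (b - a - measure lborel A)"
proof -
  note A(1)[measurable]
  have fin: "emeasure lborel A < \<infinity>"
    by (rule emeasure_bounded_finite[OF bounded_subset[OF _ A(2)]]) simp
  have "emeasure lborel ({a..b} - A) < \<infinity>"
    by (rule emeasure_bounded_finite) (auto intro: bounded_subset[of "{a..b}"])
  note fin = fin this
  have "f b - f a = (\<integral>x. indicator {a..b} x * D x \<partial>lborel)"
    using lipschitz_integral_derivative(2)[OF f \<open>a \<le> b\<close> diff D] by simp
  also have "\<dots> \<le> (\<integral>x. p * indicator A x + q * indicator ({a..b} - A) x \<partial>lborel)"
  proof (rule integral_mono_AE)
    show "integrable lborel (\<lambda>x. indicator {a..b} x * D x)"
      by (rule lipschitz_integral_derivative(1)[OF f \<open>a \<le> b\<close> diff D])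
    show "integrable lborel (\<lambda>x. p * indicator A x + q * indicator ({a..b} - A) x)"
      using fin by (intro Bochner_Integration.integrable_add integrable_mult_right integrable_real_indicator) auto
    show "AE x in lborel. indicator {a..b} x * D x \<le> p * indicator A x + q * indicator ({a..b} - A) x"
      using p q by eventually_elim (use A(2) in \<open>auto simp: indicator_def\<close>)
  qed
  also have "\<dots> = p * measure lborel A + q * measure lborel ({a..b} - A)"
    using fin by (subst Bochner_Integration.integral_add) auto
  also have "measure lborel ({a..b} - A) = b - a - measure lborel A"
    using fin A \<open>a \<le> b\<close> by (subst measure_Diff) auto
  finally show ?thesis .
qed

section \<open>Loops with unit speed almost everywhere\<close>

text \<open>
  The component of \<open>w\<close> perpendicular to the unit vector \<open>u\<close>. Its norm at \<open>u = \<Gamma>' t\<close>,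
  \<open>w = \<Gamma> s - \<Gamma> t\<close> is the distance of \<open>\<Gamma> s\<close> to the tangent line at \<open>\<Gamma> t\<close>; unlike that distance it
  is linear in \<open>w\<close>.
\<close>

definition perp :: "'a::real_inner \<Rightarrow> 'a \<Rightarrow> 'a" where
  "perp u w = w - (w \<bullet> u) *\<^sub>R u"

lemma perp_diff: "perp u (w - w') = perp u w - perp u w'"
  by (simp add: perp_def algebra_simps inner_diff_left)

lemma norm_perp_sq:
  assumes "norm u = 1"
  shows "(norm (perp u w))\<^sup>2 = (norm w)\<^sup>2 - (w \<bullet> u)\<^sup>2"
proof -
  have "u \<bullet> u = 1" using assms by (simp add: dot_square_norm)
  then show ?thesis
    unfolding perp_def power2_norm_eq_inner
    by (simp add: inner_diff_left inner_diff_right inner_commute power2_eq_square algebra_simps)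
qed

lemma norm_perp_le:
  assumes "norm u = 1"
  shows "norm (perp u w) \<le> norm w"
  by (rule power2_le_imp_le) (simp_all add: norm_perp_sq[OF assms])

lemma norm_perp_le_infdist_line:
  assumes "norm u = 1"
  shows "norm (perp u (x - p)) \<le> infdist x {p + \<mu> *\<^sub>R u | \<mu>. True}"
proof -
  have u: "u \<bullet> u = 1" using assms by (simp add: dot_square_norm)
  have "norm (perp u (x - p)) \<le> dist x (p + \<mu> *\<^sub>R u)" for \<mu>
  proof -
    have "perp u (x - p) = perp u (x - (p + \<mu> *\<^sub>R u))"
      using u by (simp add: perp_def algebra_simps inner_diff_left inner_add_left)
    then show ?thesis using norm_perp_le[OF assms] by (simp add: dist_norm)
  qed
  then show ?thesis
    unfolding infdist_def by (auto intro!: cINF_greatest)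
qed

lemma emeasure_lborel_shift:
  fixes a :: real
  assumes "A \<in> sets borel"
  shows "emeasure lborel {x. x + a \<in> A} = emeasure lborel A"
proof -
  have "emeasure lborel A = emeasure (distr lborel borel ((+) a)) A"
    by (simp add: lborel_distr_plus)
  also have "\<dots> = emeasure lborel {x. x + a \<in> A}"
    using assms by (subst emeasure_distr) (auto simp: vimage_def add.commute)
  finally show ?thesis by simp
qed

lemma emeasure_lborel_bounded:
  "bounded A \<Longrightarrow> emeasure lborel A = ennreal (measure lborel A)"
  by (rule emeasure_eq_ennreal_measure) (use emeasure_bounded_finite[of A] in auto)

lemma measure_lborel_mono:
  assumes "A \<subseteq> B" "A \<in> sets borel" "B \<in> sets borel" "bounded B"
  shows "measure lborel A \<le> measure lborel B"
  using assms emeasure_bounded_finite[of B]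
  by (intro measure_mono_fmeasurable) (auto simp: fmeasurable_def)

text \<open>
  The definition of the vector derivative divides by \<open>\<bar>h\<bar>\<close>; here the quotient keeps the sign of
  \<open>h\<close>.
\<close>

lemma slope_tendsto:
  fixes f :: "real \<Rightarrow> 'a::real_normed_vector"
  assumes "(f has_vector_derivative v) (at t)"
  shows "((\<lambda>h. (f (t + h) - f t) /\<^sub>R h) \<longlongrightarrow> v) (at 0)"
proof -
  have lim: "((\<lambda>h. norm ((1 / \<bar>h\<bar>) *\<^sub>R (f (t + h) - (f t + h *\<^sub>R v)))) \<longlongrightarrow> 0) (at 0)"
  proof -
    have "((\<lambda>y. (1 / \<bar>y - t\<bar>) *\<^sub>R (f y - (f t + (y - t) *\<^sub>R v))) \<longlongrightarrow> 0) (at t)"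
      using assms by (simp add: has_vector_derivative_def has_derivative_at2)
    from tendsto_norm_zero[OF LIM_offset_zero[OF this]] show ?thesis by simp
  qed
  have eq: "norm ((1 / \<bar>h\<bar>) *\<^sub>R (f (t + h) - (f t + h *\<^sub>R v)))
      = norm ((f (t + h) - f t) /\<^sub>R h - v)" if "h \<noteq> 0" for h
  proof -
    have "(f (t + h) - f t) /\<^sub>R h - v = (1 / h) *\<^sub>R (f (t + h) - (f t + h *\<^sub>R v))"
      using that by (simp add: algebra_simps divide_inverse)
    then show ?thesis by simp
  qed
  have "((\<lambda>h. norm ((f (t + h) - f t) /\<^sub>R h - v)) \<longlongrightarrow> 0) (at 0)"
    by (rule Lim_transform_eventually[OF lim]) (use eq in \<open>auto simp: eventually_at intro!: exI[of _ 1] simp del: norm_scaleR\<close>)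
  then show ?thesis
    by (simp add: tendsto_norm_zero_iff LIM_zero_iff)
qed

locale unit_speed_loop =
  fixes L :: real and \<Gamma> :: "real \<Rightarrow> real^3"
  assumes L_pos: "0 < L"
    and periodic: "\<And>t. \<Gamma> (t + L) = \<Gamma> t"
    and inj: "inj_on \<Gamma> {0..<L}"
    and lipschitz: "\<exists>C. C-lipschitz_on UNIV \<Gamma>"
    and unit_speed: "AE t in lborel. \<exists>v. (\<Gamma> has_vector_derivative v) (at t) \<and> norm v = 1"
begin

text \<open>
  A limit along a fixed sequence of difference quotients is measurable by construction, and it is
  the derivative wherever the curve has one.
\<close>

definition tang :: "real \<Rightarrow> real^3" where
  "tang t = lim (\<lambda>n :: nat. (real n + 1) *\<^sub>R (\<Gamma> (t + 1 / (real n + 1)) - \<Gamma> t))"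

definition regular :: "real \<Rightarrow> bool" where
  "regular t \<longleftrightarrow> (\<Gamma> has_vector_derivative tang t) (at t) \<and> norm (tang t) = 1"

lemma continuous: "continuous_on A \<Gamma>"
  using lipschitz by (metis continuous_on_subset lipschitz_on_continuous_on subset_UNIV)

lemma measurable_curve [measurable]: "\<Gamma> \<in> borel_measurable borel"
  using continuous by (rule borel_measurable_continuous_onI)

lemma measurable_tang [measurable]: "tang \<in> borel_measurable borel"
  unfolding tang_def by measurable

lemma tang_eq:
  assumes "(\<Gamma> has_vector_derivative v) (at t)"
  shows "tang t = v"
proof -
  have h0: "(\<lambda>n. 1 / (real n + 1)) \<longlonglongrightarrow> 0"
    using LIMSEQ_inverse_real_of_nat by (simp add: inverse_eq_divide add.commute)
  then have "filterlim (\<lambda>n. 1 / (real n + 1)) (at 0) sequentially"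
    by (auto simp: filterlim_at intro!: always_eventually)
  then have "(\<lambda>n. (\<Gamma> (t + 1 / (real n + 1)) - \<Gamma> t) /\<^sub>R (1 / (real n + 1))) \<longlonglongrightarrow> v"
    by (rule filterlim_compose[OF slope_tendsto[OF assms]])
  then have "(\<lambda>n. (real n + 1) *\<^sub>R (\<Gamma> (t + 1 / (real n + 1)) - \<Gamma> t)) \<longlonglongrightarrow> v"
    by (simp add: divide_inverse)
  then show ?thesis unfolding tang_def by (rule limI)
qed

lemma AE_regular: "AE t in lborel. regular t"
  using unit_speed by eventually_elim (auto simp: regular_def dest: tang_eq)

lemma ex_regular:
  assumes "a < b"
  obtains x where "x \<in> {a..b}" "regular x"
proof -
  have "\<exists>x\<in>{a..b}. regular x"
  proof (rule ccontr)
    assume "\<not> ?thesis"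
    then have "AE x in lborel. x \<notin> {a..b}" using AE_regular by (auto elim: eventually_mono)
    then have "emeasure lborel {a..b} = 0" by (subst (asm) AE_iff_null_sets[symmetric]) auto
    then show False using assms by simp
  qed
  then show ?thesis using that by blast
qed

lemma periodic_int: "\<Gamma> (t + of_int k * L) = \<Gamma> t"
proof -
  have nat: "\<Gamma> (t + of_nat n * L) = \<Gamma> t" for n t
    by (induction n) (simp_all add: algebra_simps, metis add.assoc add.commute periodic)
  show ?thesis
  proof (cases k)
    case (nonneg n)
    then show ?thesis using nat by simp
  next
    case (neg n)
    then have "(of_int k :: real) = - of_nat (Suc n)" by simp
    then have "t + of_int k * L + of_nat (Suc n) * L = t" by (simp only: minus_mult_left[symmetric])
    then show ?thesis using nat[of "t + of_int k * L" "Suc n"] by (simp only:)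
  qed
qed

lemma tang_periodic_int: "tang (t + of_int k * L) = tang t"
proof -
  have "\<Gamma> (t + of_int k * L + h) = \<Gamma> (t + h)" for h
    using periodic_int[of "t + h" k] by (simp add: add_ac)
  then show ?thesis unfolding tang_def by (simp add: periodic_int)
qed

lemma neq_if_close:
  assumes "s < t" "t < s + L"
  shows "\<Gamma> s \<noteq> \<Gamma> t"
proof
  assume eq: "\<Gamma> s = \<Gamma> t"
  define k where "k = - \<lfloor>s / L\<rfloor>"
  define s' t' where "s' = s + of_int k * L" and "t' = t + of_int k * L"
  have "of_int \<lfloor>s / L\<rfloor> * L \<le> s" "s < (of_int \<lfloor>s / L\<rfloor> + 1) * L"
    using L_pos by (simp_all add: pos_le_divide_eq[symmetric] pos_divide_less_eq[symmetric])
  then have s': "s' \<in> {0..<L}" by (simp add: s'_def k_def algebra_simps)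
  have st: "s' < t'" "t' < s' + L" using assms by (simp_all add: s'_def t'_def)
  have eq': "\<Gamma> s' = \<Gamma> t'" using eq by (simp add: s'_def t'_def periodic_int)
  show False
  proof (cases "t' < L")
    case True
    then show False using inj_onD[OF inj eq'] s' st by auto
  next
    case False
    moreover have "\<Gamma> s' = \<Gamma> (t' - L)" using eq' periodic[of "t' - L"] by simp
    ultimately show False using inj_onD[OF inj, of s' "t' - L"] s' st by auto
  qed
qed

lemma has_real_derivative_inner:
  assumes "regular t"
  shows "((\<lambda>x. \<Gamma> x \<bullet> w) has_real_derivative tang t \<bullet> w) (at t)"
  using assms bounded_linear.has_vector_derivative[OF bounded_linear_inner_left]
  by (auto simp: regular_def has_real_derivative_iff_has_vector_derivative)

lemma lipschitz_inner: "\<exists>C. C-lipschitz_on UNIV (\<lambda>x. \<Gamma> x \<bullet> w)"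
proof -
  obtain C where C: "C-lipschitz_on UNIV \<Gamma>" using lipschitz by blast
  have "(C * norm w)-lipschitz_on UNIV (\<lambda>x. \<Gamma> x \<bullet> w)"
  proof (rule lipschitz_onI)
    fix x y :: real
    have "dist (\<Gamma> x \<bullet> w) (\<Gamma> y \<bullet> w) \<le> norm (\<Gamma> x - \<Gamma> y) * norm w"
      using Cauchy_Schwarz_ineq2[of "\<Gamma> x - \<Gamma> y" w] by (simp add: dist_real_def inner_diff_left)
    also have "\<dots> \<le> C * dist x y * norm w"
      using lipschitz_onD[OF C, of x y] by (intro mult_right_mono) (auto simp: dist_norm)
    finally show "dist (\<Gamma> x \<bullet> w) (\<Gamma> y \<bullet> w) \<le> C * norm w * dist x y" by (simp add: mult_ac)
  qed (use lipschitz_on_nonneg[OF C] in simp)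
  then show ?thesis by blast
qed

text \<open>
  With the well-behaved tangents of an interval as \<open>A\<close> and the bound \<open>norm w\<close> for all others, this
  turns information about most tangents into information about chords.
\<close>

lemma inner_increment_le:
  assumes "a \<le> b" and A: "A \<in> sets borel" "A \<subseteq> {a..b}"
    and p: "\<And>x. x \<in> A \<Longrightarrow> regular x \<Longrightarrow> tang x \<bullet> w \<le> p"
    and q: "\<And>x. x \<in> {a..b} - A \<Longrightarrow> regular x \<Longrightarrow> tang x \<bullet> w \<le> q"
  shows "(\<Gamma> b - \<Gamma> a) \<bullet> w \<le> p * measure lborel A + q * (b - a - measure lborel A)"
proof -
  obtain C where C: "C-lipschitz_on UNIV (\<lambda>x. \<Gamma> x \<bullet> w)" using lipschitz_inner by blast
  have "\<Gamma> b \<bullet> w - \<Gamma> a \<bullet> w \<le> p * measure lborel A + q * (b - a - measure lborel A)"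
  proof (rule lipschitz_increment_le[OF C \<open>a \<le> b\<close> _ _ A])
    show "AE x in lborel. ((\<lambda>x. \<Gamma> x \<bullet> w) has_real_derivative tang x \<bullet> w) (at x)"
      using AE_regular by eventually_elim (rule has_real_derivative_inner)
    show "(\<lambda>x. tang x \<bullet> w) \<in> borel_measurable borel" by measurable
    show "AE x in lborel. x \<in> A \<longrightarrow> tang x \<bullet> w \<le> p"
      using AE_regular by eventually_elim (simp add: p)
    show "AE x in lborel. x \<in> {a..b} - A \<longrightarrow> tang x \<bullet> w \<le> q"
      using AE_regular by eventually_elim (simp add: q)
  qed
  then show ?thesis by (simp add: inner_diff_left)
qed

text \<open>
  Integrating \<open>tang - v\<close> against the direction of the vector that is to be estimated reduces this
  to the scalar case.
\<close>

lemma norm_increment_le_of_tang: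
  assumes "a \<le> b" and close: "\<And>x. x \<in> {a..b} \<Longrightarrow> regular x \<Longrightarrow> norm (tang x - v) \<le> \<epsilon>"
  shows "norm (\<Gamma> b - \<Gamma> a - (b - a) *\<^sub>R v) \<le> \<epsilon> * (b - a)"
proof -
  let ?z = "\<Gamma> b - \<Gamma> a - (b - a) *\<^sub>R v"
  have "(\<Gamma> b - \<Gamma> a) \<bullet> ?z \<le> (\<epsilon> * norm ?z + v \<bullet> ?z) * measure lborel {a..b} + 0 * (b - a - measure lborel {a..b})"
  proof (rule inner_increment_le[OF \<open>a \<le> b\<close>])
    fix x assume x: "x \<in> {a..b}" "regular x"
    have "(tang x - v) \<bullet> ?z \<le> norm (tang x - v) * norm ?z" by (rule norm_cauchy_schwarz)
    also have "\<dots> \<le> \<epsilon> * norm ?z" using close[OF x] by (intro mult_right_mono) auto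
    finally show "tang x \<bullet> ?z \<le> \<epsilon> * norm ?z + v \<bullet> ?z" by (simp add: inner_diff_left)
  qed auto
  then have "?z \<bullet> ?z \<le> \<epsilon> * (b - a) * norm ?z"
    using \<open>a \<le> b\<close> by (simp add: inner_diff_left algebra_simps)
  then have "norm ?z * norm ?z \<le> \<epsilon> * (b - a) * norm ?z"
    by (simp add: dot_square_norm power2_eq_square)
  then show ?thesis
  proof (cases "norm ?z = 0")
    case True
    have "0 \<le> \<epsilon> * (b - a)"
    proof (cases "a = b")
      case False
      then obtain x where x: "x \<in> {a..b}" "regular x"
        using ex_regular[of a b] \<open>a \<le> b\<close> by auto
      have "0 \<le> \<epsilon>" using close[OF x] norm_ge_zero order_trans by blast
      then show ?thesis using \<open>a \<le> b\<close> by simp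
    qed simp
    then show ?thesis using True by simp
  qed simp
qed

lemma one_lipschitz: "norm (\<Gamma> b - \<Gamma> a) \<le> \<bar>b - a\<bar>"
proof -
  have "norm (\<Gamma> b - \<Gamma> a) \<le> b - a" if "a \<le> b" for a b
    using norm_increment_le_of_tang[OF that, of 0 1] by (simp add: regular_def)
  from this[of a b] this[of b a] show ?thesis
    by (cases "a \<le> b") (auto simp: norm_minus_commute)
qed

text \<open>
  If the curve returned to \<open>\<Gamma> t\<close> at \<open>s\<close>, then the right-hand side would be infinite. If \<open>\<Gamma> s\<close> is
  another point of the tangent line, then the last hypothesis fails because its right-hand side
  vanishes. In all other cases, the perpendicular component is at most the distance to the line.
\<close>

lemma le_inverse_tangent_point_radius:
  assumes t: "regular t" and "0 < q" "0 < c"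
    and c: "c * (norm (\<Gamma> s - \<Gamma> t))\<^sup>2 \<le> 2 * norm (perp (tang t) (\<Gamma> s - \<Gamma> t))"
  shows "ennreal (c powr q) \<le> 1 / ennreal_powr (tangent_point_radius \<Gamma> t s) q"
proof (cases "\<Gamma> t = \<Gamma> s")
  case True
  then show ?thesis using \<open>0 < q\<close>
    by (simp add: tangent_point_radius_def ennreal_powr_def ennreal_divide_zero)
next
  case False
  have u: "norm (tang t) = 1" using t by (simp add: regular_def)
  have line: "tangent_line \<Gamma> t = {\<Gamma> t + \<mu> *\<^sub>R tang t | \<mu>. True}"
    using t vector_derivative_at[of \<Gamma> "tang t" t] by (simp add: tangent_line_def regular_def)
  let ?n = "norm (\<Gamma> s - \<Gamma> t)" and ?D = "infdist (\<Gamma> s) (tangent_line \<Gamma> t)"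
  have n: "0 < ?n" using False by auto
  have "c * ?n\<^sup>2 \<le> 2 * ?D"
    using c norm_perp_le_infdist_line[OF u, of "\<Gamma> s" "\<Gamma> t"] by (simp add: line)
  moreover have "0 < c * ?n\<^sup>2" using n \<open>0 < c\<close> by simp
  ultimately have D: "0 < ?D" "c * ?n\<^sup>2 \<le> 2 * ?D" by auto
  have notin: "\<Gamma> s \<notin> tangent_line \<Gamma> t"
    using D(1) infdist_zero by force
  define R where "R = ?n\<^sup>2 / (2 * ?D)"
  have R: "0 < R" "c \<le> 1 / R"
    using D n by (simp_all add: R_def field_simps)
  have "tangent_point_radius \<Gamma> t s = ennreal R"
    using False notin by (simp add: tangent_point_radius_def R_def norm_minus_commute)
  then have "1 / ennreal_powr (tangent_point_radius \<Gamma> t s) q = 1 / ennreal (R powr q)"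
    using R by (simp add: ennreal_powr_def)
  also have "\<dots> = ennreal (1 / R powr q)"
    using R divide_ennreal[of 1 "R powr q"] by simp
  also have "1 / R powr q = (1 / R) powr q" using R by (simp add: powr_divide)
  finally show ?thesis
    using R(2) \<open>0 < c\<close> \<open>0 < q\<close> by (simp add: ennreal_leI powr_mono2)
qed

text \<open>
  Chebyshev's inequality for the energy on a product set, inside one period in both variables. The
  integrand is compared with a multiple of the indicator function of that set.
\<close>

lemma energy_ge_cell:
  assumes q: "0 < q" and c: "0 < c" and energy: "tangent_point_energy q L \<Gamma> \<le> ennreal E" and "0 \<le> E"
    and N: "N \<in> sets borel" "N \<subseteq> {of_int k * L..(of_int k + 1) * L}"
    and S: "S \<in> sets borel" "S \<subseteq> {of_int m * L..(of_int m + 1) * L}"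
    and far: "\<And>\<tau> \<sigma>. \<tau> \<in> N \<Longrightarrow> \<sigma> \<in> S \<Longrightarrow>
      c * (norm (\<Gamma> \<sigma> - \<Gamma> \<tau>))\<^sup>2 \<le> 2 * norm (perp (tang \<tau>) (\<Gamma> \<sigma> - \<Gamma> \<tau>))"
  shows "c powr q * measure lborel N * measure lborel S \<le> E"
proof -
  note N(1)[measurable] S(1)[measurable]
  define N' S' where "N' = {x. x + of_int k * L \<in> N}" and "S' = {x. x + of_int m * L \<in> S}"
  have [measurable]: "N' \<in> sets borel" "S' \<in> sets borel"
    unfolding N'_def S'_def by measurable
  have N': "emeasure lborel N' = emeasure lborel N" and S': "emeasure lborel S' = emeasure lborel S"
    using emeasure_lborel_shift N S by (simp_all add: N'_def S'_def)
  have sub: "N' \<subseteq> {0..L}" "S' \<subseteq> {0..L}"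
    using N(2) S(2) by (auto simp: N'_def S'_def algebra_simps subset_iff)
  let ?f = "\<lambda>t s. 1 / ennreal_powr (tangent_point_radius \<Gamma> t s) q"
  have pt: "ennreal (c powr q) \<le> ?f t s" if "regular t" "t \<in> N'" "s \<in> S'" for t s
    using that far[of "t + of_int k * L" "s + of_int m * L"] q c
    by (intro le_inverse_tangent_point_radius)
       (auto simp: N'_def S'_def periodic_int tang_periodic_int)
  have inner: "ennreal (c powr q) * emeasure lborel S' \<le> (\<integral>\<^sup>+s\<in>{0..L}. ?f t s \<partial>lborel)"
    if "regular t" "t \<in> N'" for t
  proof -
    have "ennreal (c powr q) * emeasure lborel S' = (\<integral>\<^sup>+s. ennreal (c powr q) * indicator S' s \<partial>lborel)"
      by (simp add: nn_integral_cmult_indicator)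
    also have "\<dots> \<le> (\<integral>\<^sup>+s\<in>{0..L}. ?f t s \<partial>lborel)"
      using pt[OF that] sub(2) by (intro nn_integral_mono) (auto simp: indicator_def)
    finally show ?thesis .
  qed
  have "ennreal (c powr q) * emeasure lborel S' * emeasure lborel N'
      = (\<integral>\<^sup>+t. ennreal (c powr q) * emeasure lborel S' * indicator N' t \<partial>lborel)"
    by (simp add: nn_integral_cmult_indicator)
  also have "\<dots> \<le> tangent_point_energy q L \<Gamma>"
    unfolding tangent_point_energy_def
  proof (rule nn_integral_mono_AE)
    show "AE t in lborel. ennreal (c powr q) * emeasure lborel S' * indicator N' t
        \<le> (\<integral>\<^sup>+s\<in>{0..L}. ?f t s \<partial>lborel) * indicator {0..L} t"
      using AE_regular by eventually_elim (use inner sub(1) in \<open>auto simp: indicator_def\<close>)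
  qed
  also note energy
  finally have *: "ennreal (c powr q) * emeasure lborel S * emeasure lborel N \<le> ennreal E"
    by (simp add: N' S')
  have fin: "emeasure lborel N = ennreal (measure lborel N)" "emeasure lborel S = ennreal (measure lborel S)"
    using N(2) S(2) emeasure_lborel_bounded bounded_subset[OF bounded_closed_interval] by blast+
  have "ennreal (c powr q * measure lborel S * measure lborel N) \<le> ennreal E"
    using * unfolding fin by (simp add: ennreal_mult[symmetric])
  then show ?thesis using \<open>0 \<le> E\<close> by (simp add: ennreal_le_iff mult_ac)
qed

end

section \<open>The energy aligns tangents with chords\<close>

context unit_speed_loop
begin

text \<open>
  An interval of length \<open>L\<close> is covered by two consecutive periods, which gives four products of
  cells.
\<close>

lemma energy_ge_product:
  assumes q: "0 < q" and c: "0 < c" and energy: "tangent_point_energy q L \<Gamma> \<le> ennreal E" and "0 \<le> E"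
    and N: "N \<in> sets borel" "N \<subseteq> {a..a + L}" and S: "S \<in> sets borel" "S \<subseteq> {b..b + L}"
    and far: "\<And>\<tau> \<sigma>. \<tau> \<in> N \<Longrightarrow> \<sigma> \<in> S \<Longrightarrow>
      c * (norm (\<Gamma> \<sigma> - \<Gamma> \<tau>))\<^sup>2 \<le> 2 * norm (perp (tang \<tau>) (\<Gamma> \<sigma> - \<Gamma> \<tau>))"
  shows "c powr q * measure lborel N * measure lborel S \<le> 4 * E"
proof -
  define cell where "cell k = {of_int k * L..(of_int k + 1) * L}" for k :: int
  have [measurable]: "cell k \<in> sets borel" for k by (simp add: cell_def)
  have split: "measure lborel A \<le> measure lborel (A \<inter> cell \<lfloor>x / L\<rfloor>) + measure lborel (A \<inter> cell (\<lfloor>x / L\<rfloor> + 1))"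
    if A: "A \<in> sets borel" "A \<subseteq> {x..x + L}" for A x
  proof -
    have "of_int \<lfloor>x / L\<rfloor> * L \<le> x" "x < (of_int \<lfloor>x / L\<rfloor> + 1) * L"
      using L_pos by (simp_all add: pos_le_divide_eq[symmetric] pos_divide_less_eq[symmetric])
    then have cover: "A \<inter> cell \<lfloor>x / L\<rfloor> \<union> A \<inter> cell (\<lfloor>x / L\<rfloor> + 1) = A"
      using A(2) by (auto simp: cell_def algebra_simps subset_iff)
    have "bounded (A \<inter> B)" for B
      using A(2) bounded_subset[OF bounded_closed_interval, of "A \<inter> B" x "x + L"] by blast
    then have "A \<inter> cell k \<in> fmeasurable lborel" for k
      using A(1) emeasure_bounded_finite[of "A \<inter> cell k"] by (auto simp: fmeasurable_def)
    from measure_Un_le[OF fmeasurableD[OF this] fmeasurableD[OF this]] show ?thesis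
      using cover by metis
  qed
  have piece: "c powr q * measure lborel (N \<inter> cell k) * measure lborel (S \<inter> cell m) \<le> E" for k m
    using N(1) S(1) far
    by (intro energy_ge_cell[OF q c energy \<open>0 \<le> E\<close>, where k = k and m = m]) (auto simp: cell_def)
  let ?k = "\<lfloor>a / L\<rfloor>" and ?m = "\<lfloor>b / L\<rfloor>"
  let ?n = "\<lambda>k. measure lborel (N \<inter> cell k)" and ?s = "\<lambda>m. measure lborel (S \<inter> cell m)"
  have "c powr q * measure lborel N * measure lborel S
      \<le> c powr q * (?n ?k + ?n (?k + 1)) * (?s ?m + ?s (?m + 1))"
    using split[OF N] split[OF S] by (intro mult_mono mult_nonneg_nonneg add_nonneg_nonneg) auto
  also have "\<dots> = c powr q * ?n ?k * ?s ?m + c powr q * ?n ?k * ?s (?m + 1)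
      + c powr q * ?n (?k + 1) * ?s ?m + c powr q * ?n (?k + 1) * ?s (?m + 1)"
    by (simp add: algebra_simps)
  also have "\<dots> \<le> E + E + E + E"
    by (intro add_mono piece)
  finally show ?thesis by simp
qed

text \<open>
  If the tangent line at \<open>\<Gamma> \<tau>\<close> misses \<open>\<Gamma> p\<close> by \<open>\<epsilon> d / 2\<close>, then it misses \<open>\<Gamma> \<sigma>\<close> by \<open>\<epsilon> d / 4\<close> for
  all \<open>\<sigma>\<close> in an interval of length \<open>\<epsilon> d / 4\<close> at \<open>p\<close>, as \<open>\<Gamma>\<close> is 1-Lipschitz. At distance at most
  \<open>4 d\<close> this means that the inverse tangent-point radius is at least \<open>\<epsilon> / (32 d)\<close>. So a single bad
  point \<open>p\<close> already produces a product set of positive measure with high energy density.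
\<close>

lemma measure_far_tangents_le:
  assumes q: "0 < q" and energy: "tangent_point_energy q L \<Gamma> \<le> ennreal E" and "0 \<le> E"
    and \<epsilon>: "0 < \<epsilon>" "\<epsilon> \<le> 1" and d: "0 < d" "4 * d \<le> L"
    and N: "N \<in> sets borel" "N \<subseteq> {a..a + L}"
    and near: "\<And>\<tau>. \<tau> \<in> N \<Longrightarrow> norm (\<Gamma> p - \<Gamma> \<tau>) \<le> 3 * d"
    and unit: "\<And>\<tau>. \<tau> \<in> N \<Longrightarrow> norm (tang \<tau>) = 1"
    and off: "\<And>\<tau>. \<tau> \<in> N \<Longrightarrow> \<epsilon> * d / 2 \<le> norm (perp (tang \<tau>) (\<Gamma> p - \<Gamma> \<tau>))"
  shows "measure lborel N \<le> 16 * E * 32 powr q * \<epsilon> powr (- q - 1) * d powr (q - 1)"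
proof -
  define S where "S = {p..p + \<epsilon> * d / 4}"
  define c where "c = \<epsilon> / (32 * d)"
  have c: "0 < c" using \<epsilon> d by (simp add: c_def)
  have \<epsilon>d: "\<epsilon> * d \<le> d" using \<epsilon> d by (simp add: mult_left_le_one_le)
  have prod: "c powr q * measure lborel N * measure lborel S \<le> 4 * E"
  proof (rule energy_ge_product[OF q c energy \<open>0 \<le> E\<close> N, of S p])
    have "\<epsilon> * d / 4 \<le> L" using \<epsilon>d d by linarith
    then show "S \<subseteq> {p..p + L}" by (auto simp: S_def)
    fix \<tau> \<sigma> assume \<tau>: "\<tau> \<in> N" and \<sigma>: "\<sigma> \<in> S"
    have move: "norm (\<Gamma> \<sigma> - \<Gamma> p) \<le> \<epsilon> * d / 4"
      using one_lipschitz[of \<sigma> p] \<sigma> by (simp add: S_def)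
    have "norm (\<Gamma> \<sigma> - \<Gamma> \<tau>) \<le> norm (\<Gamma> \<sigma> - \<Gamma> p) + norm (\<Gamma> p - \<Gamma> \<tau>)"
      using norm_triangle_ineq[of "\<Gamma> \<sigma> - \<Gamma> p" "\<Gamma> p - \<Gamma> \<tau>"] by simp
    also have "\<dots> \<le> 4 * d" using move near[OF \<tau>] \<epsilon>d d by linarith
    finally have "c * (norm (\<Gamma> \<sigma> - \<Gamma> \<tau>))\<^sup>2 \<le> c * (4 * d)\<^sup>2"
      using c by (intro mult_left_mono power_mono) auto
    also have "\<dots> = \<epsilon> * d / 2" using d by (simp add: c_def power2_eq_square)
    also have "\<dots> \<le> 2 * norm (perp (tang \<tau>) (\<Gamma> \<sigma> - \<Gamma> \<tau>))"
    proof -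
      have "perp (tang \<tau>) (\<Gamma> p - \<Gamma> \<tau>) = perp (tang \<tau>) (\<Gamma> \<sigma> - \<Gamma> \<tau>) - perp (tang \<tau>) (\<Gamma> \<sigma> - \<Gamma> p)"
        by (simp add: perp_diff[symmetric])
      then have "norm (perp (tang \<tau>) (\<Gamma> p - \<Gamma> \<tau>))
          \<le> norm (perp (tang \<tau>) (\<Gamma> \<sigma> - \<Gamma> \<tau>)) + norm (perp (tang \<tau>) (\<Gamma> \<sigma> - \<Gamma> p))"
        by (simp add: norm_triangle_ineq4)
      then show ?thesis
        using off[OF \<tau>] move norm_perp_le[OF unit[OF \<tau>], of "\<Gamma> \<sigma> - \<Gamma> p"] by linarith
    qed
    finally show "c * (norm (\<Gamma> \<sigma> - \<Gamma> \<tau>))\<^sup>2 \<le> 2 * norm (perp (tang \<tau>) (\<Gamma> \<sigma> - \<Gamma> \<tau>))" .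
  qed (simp add: S_def)
  have S: "measure lborel S = \<epsilon> * d / 4" using \<epsilon> d by (simp add: S_def)
  have cq: "c powr q * (\<epsilon> * d) = \<epsilon> powr (q + 1) * d powr (1 - q) / 32 powr q"
    using \<epsilon> d by (simp add: c_def powr_divide powr_mult powr_add powr_diff field_simps)
  have "c powr q * (\<epsilon> * d) * measure lborel N = 4 * (c powr q * measure lborel N * measure lborel S)"
    by (simp add: S)
  then have le: "\<epsilon> powr (q + 1) * d powr (1 - q) / 32 powr q * measure lborel N \<le> 16 * E"
    using prod unfolding cq by linarith
  have inv: "\<epsilon> powr (q + 1) * \<epsilon> powr (- q - 1) = 1" "d powr (1 - q) * d powr (q - 1) = 1"
    using \<epsilon> d by (simp_all add: powr_add[symmetric])
  let ?y = "32 powr q * \<epsilon> powr (- q - 1) * d powr (q - 1)"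
  have "measure lborel N = (\<epsilon> powr (q + 1) * \<epsilon> powr (- q - 1)) * (d powr (1 - q) * d powr (q - 1)) * measure lborel N"
    unfolding inv by simp
  also have "\<dots> = \<epsilon> powr (q + 1) * d powr (1 - q) / 32 powr q * measure lborel N * ?y"
    by simp
  also have "\<dots> \<le> 16 * E * ?y"
    using le by (rule mult_right_mono) simp
  finally show ?thesis by (simp add: mult_ac)
qed

text \<open>
  The parameters within \<open>2 d\<close> of \<open>s\<close> where the tangent makes an angle of sine more than \<open>\<epsilon>\<close> with
  the chord from \<open>\<Gamma> s\<close> to \<open>\<Gamma> t\<close>, where \<open>d\<close> is the length of the chord. Multiplying by \<open>d\<close> avoids
  normalizing the chord. The two directions of the chord are not distinguished.
\<close>

definition misaligned :: "real \<Rightarrow> real \<Rightarrow> real \<Rightarrow> real set" where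
  "misaligned \<epsilon> s t = {\<tau> \<in> {s - 2 * norm (\<Gamma> t - \<Gamma> s)..s + 2 * norm (\<Gamma> t - \<Gamma> s)}.
     \<epsilon> * norm (\<Gamma> t - \<Gamma> s) < norm (perp (tang \<tau>) (\<Gamma> t - \<Gamma> s))}"

lemma misaligned_borel [measurable]: "misaligned \<epsilon> s t \<in> sets borel"
  unfolding misaligned_def perp_def by measurable

text \<open>
  A tangent line that passes near both end points of the chord is nearly parallel to it. So at a
  misaligned parameter the tangent line misses one of the end points. For \<open>\<epsilon> > 1\<close> the set is null.
\<close>

lemma measure_misaligned_le_energy:
  assumes q: "0 < q" and energy: "tangent_point_energy q L \<Gamma> \<le> ennreal E" and "0 \<le> E"
    and \<epsilon>: "0 < \<epsilon>" and d: "d = norm (\<Gamma> t - \<Gamma> s)" "0 < d" "4 * d \<le> L"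
  shows "measure lborel (misaligned \<epsilon> s t) \<le> 32 * E * 32 powr q * \<epsilon> powr (- q - 1) * d powr (q - 1)"
proof (cases "\<epsilon> \<le> 1")
  case True
  let ?J = "{s - 2 * d..s + 2 * d}"
  define N where "N p = {\<tau> \<in> ?J. norm (tang \<tau>) = 1 \<and> \<epsilon> * d / 2 \<le> norm (perp (tang \<tau>) (\<Gamma> p - \<Gamma> \<tau>))}" for p
  have [measurable]: "N p \<in> sets borel" for p unfolding N_def perp_def by measurable
  have bound: "measure lborel (N p) \<le> 16 * E * 32 powr q * \<epsilon> powr (- q - 1) * d powr (q - 1)"
    if "norm (\<Gamma> p - \<Gamma> s) \<le> d" for p
  proof (rule measure_far_tangents_le[OF q energy \<open>0 \<le> E\<close> \<epsilon> True d(2,3), of _ "s - 2 * d" p])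
    show "N p \<subseteq> {s - 2 * d..s - 2 * d + L}" using d by (auto simp: N_def)
    fix \<tau> assume \<tau>: "\<tau> \<in> N p"
    have "norm (\<Gamma> p - \<Gamma> \<tau>) \<le> norm (\<Gamma> p - \<Gamma> s) + norm (\<Gamma> s - \<Gamma> \<tau>)"
      using norm_triangle_ineq[of "\<Gamma> p - \<Gamma> s" "\<Gamma> s - \<Gamma> \<tau>"] by simp
    also have "norm (\<Gamma> s - \<Gamma> \<tau>) \<le> 2 * d"
      using one_lipschitz[of s \<tau>] \<tau> by (auto simp: N_def abs_if split: if_splits)
    finally show "norm (\<Gamma> p - \<Gamma> \<tau>) \<le> 3 * d" using that by simp
    show "norm (tang \<tau>) = 1" "\<epsilon> * d / 2 \<le> norm (perp (tang \<tau>) (\<Gamma> p - \<Gamma> \<tau>))"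
      using \<tau> by (simp_all add: N_def)
  qed measurable
  have "AE \<tau> in lborel. \<tau> \<in> misaligned \<epsilon> s t \<longrightarrow> \<tau> \<in> N s \<union> N t"
    using AE_regular
  proof eventually_elim
    case (elim \<tau>)
    show ?case
    proof
      assume \<tau>: "\<tau> \<in> misaligned \<epsilon> s t"
      have "perp (tang \<tau>) (\<Gamma> t - \<Gamma> s) = perp (tang \<tau>) (\<Gamma> t - \<Gamma> \<tau>) - perp (tang \<tau>) (\<Gamma> s - \<Gamma> \<tau>)"
        by (simp add: perp_diff[symmetric])
      then have "norm (perp (tang \<tau>) (\<Gamma> t - \<Gamma> s))
          \<le> norm (perp (tang \<tau>) (\<Gamma> t - \<Gamma> \<tau>)) + norm (perp (tang \<tau>) (\<Gamma> s - \<Gamma> \<tau>))"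
        by (simp add: norm_triangle_ineq4)
      then show "\<tau> \<in> N s \<union> N t"
        using \<tau> elim by (auto simp: misaligned_def N_def regular_def d(1)[symmetric])
    qed
  qed
  then have "emeasure lborel (misaligned \<epsilon> s t) \<le> emeasure lborel (N s \<union> N t)"
    by (intro emeasure_mono_AE) auto
  moreover have "bounded (misaligned \<epsilon> s t)" "bounded (N s \<union> N t)"
    by (auto simp: misaligned_def N_def intro: bounded_subset[OF bounded_closed_interval])
  ultimately have "measure lborel (misaligned \<epsilon> s t) \<le> measure lborel (N s \<union> N t)"
    by (simp add: emeasure_lborel_bounded)
  also have "\<dots> \<le> measure lborel (N s) + measure lborel (N t)"
    by (rule measure_Un_le) auto
  also have "\<dots> \<le> 32 * E * 32 powr q * \<epsilon> powr (- q - 1) * d powr (q - 1)"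
    using bound[of s] bound[of t] d by simp
  finally show ?thesis .
next
  case False
  have "AE \<tau> in lborel. \<tau> \<notin> misaligned \<epsilon> s t"
    using AE_regular
  proof eventually_elim
    case (elim \<tau>)
    have "norm (perp (tang \<tau>) (\<Gamma> t - \<Gamma> s)) \<le> \<epsilon> * norm (\<Gamma> t - \<Gamma> s)"
      using norm_perp_le[of "tang \<tau>" "\<Gamma> t - \<Gamma> s"] elim False mult_right_mono[of 1 \<epsilon> "norm (\<Gamma> t - \<Gamma> s)"]
      by (auto simp: regular_def)
    then show ?case by (auto simp: misaligned_def)
  qed
  then have "emeasure lborel (misaligned \<epsilon> s t) = 0"
    by (subst (asm) AE_iff_null_sets[symmetric]) auto
  then show ?thesis using \<open>0 \<le> E\<close> by (simp add: measure_def)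
qed

end

text \<open>
  What the energy bound is used for. The estimate concerns all pairs of nearby points of the
  curve, close to each other in parameter or not, and this is what rules out both folds and
  self-approach.
\<close>

locale aligned_loop = unit_speed_loop +
  fixes C \<alpha> :: real
  assumes C_pos: "0 < C" and \<alpha>_pos: "0 < \<alpha>"
    and aligned: "\<And>s t. \<Gamma> s \<noteq> \<Gamma> t \<Longrightarrow> 4 * norm (\<Gamma> t - \<Gamma> s) \<le> L \<Longrightarrow>
      measure lborel (misaligned (C * norm (\<Gamma> t - \<Gamma> s) powr \<alpha>) s t)
        \<le> C * norm (\<Gamma> t - \<Gamma> s) powr \<alpha> * norm (\<Gamma> t - \<Gamma> s)"

text \<open>
  The value \<open>\<epsilon> = C d\<^sup>\<alpha>\<close> balances the bound for the measure of the misaligned set, which is a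
  constant times \<open>\<epsilon> powr (- q - 1) * d powr (q - 1)\<close>, with \<open>\<epsilon> d\<close>. The exponent \<open>\<alpha>\<close> is positive
  because \<open>q > 2\<close>.
\<close>

lemma (in unit_speed_loop) aligned_loop_if_energy_le:
  assumes q: "2 < q" and "0 < E" and energy: "tangent_point_energy q L \<Gamma> \<le> ennreal E"
  shows "aligned_loop L \<Gamma> ((32 * E * 32 powr q) powr (1 / (q + 2))) ((q - 2) / (q + 2))"
proof unfold_locales
  let ?A = "32 * E * 32 powr q"
  let ?C = "?A powr (1 / (q + 2))" and ?\<alpha> = "(q - 2) / (q + 2)"
  show "0 < ?C" using \<open>0 < E\<close> by simp
  show "0 < ?\<alpha>" using q by simp
  fix s t
  assume "\<Gamma> s \<noteq> \<Gamma> t" and d4: "4 * norm (\<Gamma> t - \<Gamma> s) \<le> L"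
  define d where "d = norm (\<Gamma> t - \<Gamma> s)"
  have d: "0 < d" using \<open>\<Gamma> s \<noteq> \<Gamma> t\<close> by (simp add: d_def)
  define \<epsilon> where "\<epsilon> = ?C * d powr ?\<alpha>"
  have \<epsilon>: "0 < \<epsilon>" using d \<open>0 < E\<close> by (simp add: \<epsilon>_def)
  have "\<epsilon> powr (q + 2) = ?A * d powr (q - 2)"
    using \<open>0 < E\<close> d q by (simp add: \<epsilon>_def powr_mult powr_powr)
  then have "?A * \<epsilon> powr (- q - 1) * d powr (q - 1) = \<epsilon> powr (q + 2) * \<epsilon> powr (- q - 1) * (d powr (q - 1) / d powr (q - 2))"
    using d by (simp add: field_simps)
  also have "\<dots> = \<epsilon> * d"
    using d \<epsilon> by (simp add: powr_add[symmetric] powr_diff[symmetric])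
  finally show "measure lborel (misaligned (?C * norm (\<Gamma> t - \<Gamma> s) powr ?\<alpha>) s t)
      \<le> ?C * norm (\<Gamma> t - \<Gamma> s) powr ?\<alpha> * norm (\<Gamma> t - \<Gamma> s)"
    using measure_misaligned_le_energy[OF _ energy _ \<epsilon> d_def d] q d4 \<open>0 < E\<close>
    by (simp add: d_def[symmetric] \<epsilon>_def[symmetric])
qed

section \<open>No folds: chords against arcs at small scales\<close>

text \<open>
  The weak-type inequality for the one-sided maximal function of the indicator of \<open>N\<close> at the level
  one half: the points at which some adjacent interval is half filled by \<open>N\<close> form a small set. The
  intervals are balls around their midpoints, so that Vitali's covering lemma applies; a cover in
  place of the set itself avoids measurability questions.
\<close>

lemma dense_points_cover:
  fixes N :: "real set"
  assumes N: "N \<in> sets borel" "bounded N"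
  obtains U where "U \<in> sets borel" "bounded U" "measure lborel U \<le> 10 * measure lborel N"
    and "\<And>x y. \<lbrakk>x \<in> {a..b}; y \<in> {a..b}; x \<noteq> y; \<bar>x - y\<bar> / 2 \<le> measure lborel (N \<inter> closed_segment x y)\<rbrakk> \<Longrightarrow> x \<in> U"
proof -
  define K where "K = {(x, y). x \<in> {a..b} \<and> y \<in> {a..b} \<and> x \<noteq> y \<and>
    \<bar>x - y\<bar> / 2 \<le> measure lborel (N \<inter> closed_segment x y)}"
  define c r where "c = (\<lambda>(x, y). (x + y) / 2 :: real)" and "r = (\<lambda>(x, y). \<bar>x - y\<bar> / 2 :: real)"
  have ball: "cball (c p) (r p) = closed_segment (fst p) (snd p)" for p
    by (auto simp: c_def r_def cball_eq_atLeastAtMost closed_segment_eq_real_ivl case_prod_beta abs_if field_simps)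
  have r: "0 < r p \<and> r p \<le> b - a" if "p \<in> K" for p
    using that by (auto simp: K_def r_def)
  have cover: "fst ` K \<subseteq> (\<Union>p\<in>K. cball (c p) (r p))"
    by (auto simp: ball)
  obtain D where D: "countable D" "D \<subseteq> K"
      "pairwise (\<lambda>i j. disjnt (cball (c i) (r i)) (cball (c j) (r j))) D"
      "fst ` K \<subseteq> (\<Union>p\<in>D. cball (c p) (5 * r p))"
    by (rule Vitali_covering_lemma_cballs[OF cover r]) (assumption, rule that)
  define U where "U = (\<Union>p\<in>D. cball (c p) (5 * r p))"
  have N_fm: "N \<inter> cball x e \<in> fmeasurable lborel" for x e
    using N emeasure_bounded_finite[of "N \<inter> cball x e"]
    by (auto simp: fmeasurable_def intro: bounded_subset)
  have "measure lborel U \<le> 10 * measure lborel N"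
    unfolding U_def
  proof (rule measure_UN_bound[OF D(1)])
    fix F assume F: "F \<subseteq> D" "finite F"
    have "measure lborel (\<Union>p\<in>F. cball (c p) (5 * r p)) \<le> (\<Sum>p\<in>F. measure lborel (cball (c p) (5 * r p)))"
      by (intro measure_UNION_le F) auto
    also have "\<dots> \<le> (\<Sum>p\<in>F. 10 * measure lborel (N \<inter> cball (c p) (r p)))"
    proof (rule sum_mono)
      fix p assume "p \<in> F"
      then have p: "p \<in> K" using F D by auto
      have "measure lborel (cball (c p) (5 * r p)) = 10 * r p"
        using r[OF p] by (simp add: cball_eq_atLeastAtMost)
      also have "\<dots> \<le> 10 * measure lborel (N \<inter> cball (c p) (r p))"
        using p unfolding ball by (auto simp: K_def r_def)
      finally show "measure lborel (cball (c p) (5 * r p)) \<le> 10 * measure lborel (N \<inter> cball (c p) (r p))" .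
    qed
    also have "\<dots> = 10 * measure lborel (\<Union>p\<in>F. N \<inter> cball (c p) (r p))"
    proof -
      have "disjoint_family_on (\<lambda>p. N \<inter> cball (c p) (r p)) F"
        unfolding disjoint_family_on_def
      proof (intro ballI impI)
        fix p q assume "p \<in> F" "q \<in> F" "p \<noteq> q"
        then have "disjnt (cball (c p) (r p)) (cball (c q) (r q))"
          using D(3) F(1) unfolding pairwise_def by (meson subsetD)
        then show "N \<inter> cball (c p) (r p) \<inter> (N \<inter> cball (c q) (r q)) = {}"
          unfolding disjnt_def by blast
      qed
      then show ?thesis
        using N_fm by (subst measure_finite_Union[OF F(2)])
          (auto simp: sum_distrib_left image_subset_iff fmeasurable_def less_top)
    qed
    also have "\<dots> \<le> 10 * measure lborel N"
      using N emeasure_bounded_finite[of N] F N_fm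
      by (intro mult_left_mono measure_mono_fmeasurable sets.finite_UN)
         (auto simp: fmeasurable_def)
    finally show "measure lborel (\<Union>p\<in>F. cball (c p) (5 * r p)) \<le> 10 * measure lborel N" .
  qed (use emeasure_bounded_finite[OF bounded_cball] in \<open>auto simp: fmeasurable_def\<close>)
  moreover have "U \<in> sets borel"
    unfolding U_def using D(1) by (intro sets.countable_UN') auto
  moreover have "bounded U"
  proof -
    have "cball (c p) (5 * r p) \<subseteq> {a - 5 * (b - a)..b + 5 * (b - a)}" if "p \<in> D" for p
    proof -
      have "p \<in> K" using that D by auto
      then have "a \<le> c p" "c p \<le> b" "r p \<le> b - a"
        using r[of p] by (auto simp: K_def c_def)
      then show ?thesis by (auto simp: cball_eq_atLeastAtMost)
    qed
    then have "U \<subseteq> {a - 5 * (b - a)..b + 5 * (b - a)}" unfolding U_def by blast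
    then show ?thesis by (rule bounded_subset[OF bounded_closed_interval])
  qed
  moreover have "x \<in> U" if "x \<in> {a..b}" "y \<in> {a..b}" "x \<noteq> y" "\<bar>x - y\<bar> / 2 \<le> measure lborel (N \<inter> closed_segment x y)" for x y
  proof -
    have "(x, y) \<in> K" using that by (simp add: K_def)
    then have "x \<in> fst ` K" by force
    then show ?thesis using D(4) unfolding U_def by (rule rev_subsetD)
  qed
  ultimately show ?thesis using that by blast
qed

text \<open>
  Bessel's inequality for two orthogonal vectors, multiplied out so that they may be zero.
\<close>

lemma bessel_two:
  fixes u w w' :: "'a::real_inner"
  assumes "norm u = 1" "w \<bullet> w' = 0"
  shows "(w \<bullet> u)\<^sup>2 * (norm w')\<^sup>2 + (w' \<bullet> u)\<^sup>2 * (norm w)\<^sup>2 \<le> (norm w)\<^sup>2 * (norm w')\<^sup>2"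
proof -
  define X where "X = (w \<bullet> u)\<^sup>2 * (norm w')\<^sup>2 + (w' \<bullet> u)\<^sup>2 * (norm w)\<^sup>2"
  define z where "z = ((w \<bullet> u) * (norm w')\<^sup>2) *\<^sub>R w + ((w' \<bullet> u) * (norm w)\<^sup>2) *\<^sub>R w'"
  have "u \<bullet> z = X"
    by (simp add: z_def X_def inner_add_right inner_commute power2_eq_square)
  moreover have "z \<bullet> z = (norm w)\<^sup>2 * (norm w')\<^sup>2 * X"
    using assms(2)
    by (simp add: z_def X_def inner_add_right inner_add_left inner_commute[of w' w] power2_norm_eq_inner)
       (simp add: power2_eq_square algebra_simps)
  moreover have "(u \<bullet> z)\<^sup>2 \<le> z \<bullet> z"
    using Cauchy_Schwarz_ineq[of u z] assms(1) by (simp add: dot_square_norm)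
  ultimately have "X * X \<le> (norm w)\<^sup>2 * (norm w')\<^sup>2 * X"
    by (simp add: power2_eq_square)
  moreover have "0 \<le> X" by (simp add: X_def)
  ultimately show ?thesis
    unfolding X_def[symmetric] by (cases "X = 0") (auto simp: mult_le_cancel_right)
qed

context aligned_loop
begin

lemma bounded_misaligned: "bounded (misaligned \<epsilon> s t)"
  by (rule bounded_subset[OF bounded_closed_interval]) (auto simp: misaligned_def)

lemma measure_misaligned_le:
  assumes neq: "\<Gamma> s \<noteq> \<Gamma> t" and st: "norm (\<Gamma> t - \<Gamma> s) \<le> x" and x: "4 * x \<le> L" "C * x powr \<alpha> \<le> \<epsilon>"
  shows "measure lborel (misaligned \<epsilon> s t) \<le> \<epsilon> * norm (\<Gamma> t - \<Gamma> s)"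
proof -
  define d where "d = norm (\<Gamma> t - \<Gamma> s)"
  have d: "0 < d" "d \<le> x" using st neq by (auto simp: d_def)
  have "C * d powr \<alpha> \<le> C * x powr \<alpha>"
    using C_pos \<alpha>_pos d by (intro mult_left_mono powr_mono2) auto
  then have \<epsilon>: "C * d powr \<alpha> \<le> \<epsilon>" using x by simp
  have "C * d powr \<alpha> * d \<le> \<epsilon> * d" using \<epsilon> d by (intro mult_right_mono) auto
  then have "misaligned \<epsilon> s t \<subseteq> misaligned (C * d powr \<alpha>) s t"
    unfolding misaligned_def d_def[symmetric] by (blast intro: le_less_trans)
  moreover have "bounded (misaligned (C * d powr \<alpha>) s t)"
    by (auto simp: misaligned_def intro: bounded_subset[OF bounded_closed_interval])
  ultimately have "measure lborel (misaligned \<epsilon> s t) \<le> measure lborel (misaligned (C * d powr \<alpha>) s t)"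
    by (intro measure_lborel_mono) auto
  also have "\<dots> \<le> C * d powr \<alpha> * d"
    using aligned[OF neq] d x by (simp add: d_def[symmetric])
  also have "\<dots> \<le> \<epsilon> * d" using \<epsilon> d by (intro mult_right_mono) auto
  finally show ?thesis by (simp add: d_def)
qed

lemma chord_ge_if_not_misaligned:
  assumes "norm (tang \<tau>) = 1" "\<tau> \<notin> misaligned \<epsilon> s t" "\<bar>\<tau> - s\<bar> \<le> 2 * norm (\<Gamma> t - \<Gamma> s)" "0 \<le> \<epsilon>"
  shows "(1 - \<epsilon>\<^sup>2) * (norm (\<Gamma> t - \<Gamma> s))\<^sup>2 \<le> ((\<Gamma> t - \<Gamma> s) \<bullet> tang \<tau>)\<^sup>2"
proof -
  have "norm (perp (tang \<tau>) (\<Gamma> t - \<Gamma> s)) \<le> \<epsilon> * norm (\<Gamma> t - \<Gamma> s)"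
    using assms(2,3) by (auto simp: misaligned_def)
  then have "(norm (perp (tang \<tau>) (\<Gamma> t - \<Gamma> s)))\<^sup>2 \<le> (\<epsilon> * norm (\<Gamma> t - \<Gamma> s))\<^sup>2"
    by (intro power_mono) auto
  then show ?thesis
    using norm_perp_sq[OF assms(1)] by (simp add: power_mult_distrib algebra_simps)
qed

text \<open>
  Two points of the arc at the same height over its chord span a chord that is perpendicular to
  it. Tangents aligned with the one are misaligned with the other, by Bessel's inequality. The
  interval between \<open>\<sigma>\<close> and \<open>y\<close> has the length of the perpendicular chord, so nearly all of its
  tangents are aligned with that chord.
\<close>

lemma half_misaligned_if_level:
  assumes x: "4 * (t - s) \<le> L" "C * (t - s) powr \<alpha> \<le> 1 / 100"
    and long: "t - s \<le> 2 * norm (\<Gamma> t - \<Gamma> s)"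
    and \<sigma>: "\<sigma> \<in> {s..t}" "\<sigma>' \<in> {s..t}" "\<sigma> \<noteq> \<sigma>'"
    and level: "(\<Gamma> \<sigma>' - \<Gamma> \<sigma>) \<bullet> (\<Gamma> t - \<Gamma> s) = 0"
  shows "\<exists>y\<in>{s..t}. \<sigma> \<noteq> y \<and>
    \<bar>\<sigma> - y\<bar> / 2 \<le> measure lborel (misaligned (1/100) s t \<inter> {s..t} \<inter> closed_segment \<sigma> y)"
proof -
  define d where "d = norm (\<Gamma> \<sigma>' - \<Gamma> \<sigma>)"
  define y where "y = (if \<sigma> < \<sigma>' then \<sigma> + d else \<sigma> - d)"
  let ?w = "\<Gamma> t - \<Gamma> s" and ?w' = "\<Gamma> \<sigma>' - \<Gamma> \<sigma>" and ?N = "misaligned (1/100) s t \<inter> {s..t}"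
  have "s < t" using \<sigma> by auto
  have "\<Gamma> \<sigma> \<noteq> \<Gamma> \<sigma>'"
    using neq_if_close[of \<sigma> \<sigma>'] neq_if_close[of \<sigma>' \<sigma>] \<sigma> x L_pos by (cases "\<sigma> < \<sigma>'") auto
  then have d: "0 < d" "d \<le> \<bar>\<sigma>' - \<sigma>\<bar>"
    using one_lipschitz[of \<sigma>' \<sigma>] by (auto simp: d_def)
  have y: "y \<in> {s..t}" "\<sigma> \<noteq> y" "\<bar>\<sigma> - y\<bar> = d"
    using d \<sigma> by (auto simp: y_def)
  have seg: "closed_segment \<sigma> y \<subseteq> {s..t}"
    using y \<sigma> by (auto simp: closed_segment_eq_real_ivl)
  have w: "0 < norm ?w" using long \<open>s < t\<close> by auto
  have "AE \<tau> in lborel. \<tau> \<in> closed_segment \<sigma> y \<longrightarrow> \<tau> \<in> (?N \<inter> closed_segment \<sigma> y) \<union> misaligned (1/100) \<sigma> \<sigma>'"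
    using AE_regular
  proof eventually_elim
    case (elim \<tau>)
    then have u: "norm (tang \<tau>) = 1" by (simp add: regular_def)
    show ?case
    proof (intro impI, rule ccontr)
      assume \<tau>: "\<tau> \<in> closed_segment \<sigma> y" "\<tau> \<notin> ?N \<inter> closed_segment \<sigma> y \<union> misaligned (1/100) \<sigma> \<sigma>'"
      then have "\<tau> \<in> {s..t}" using seg by auto
      have "\<bar>\<tau> - \<sigma>\<bar> \<le> 2 * d"
        using \<tau>(1) y d by (auto simp: closed_segment_eq_real_ivl split: if_splits)
      then have 1: "(1 - (1/100)\<^sup>2) * (norm ?w')\<^sup>2 \<le> (?w' \<bullet> tang \<tau>)\<^sup>2"
        using chord_ge_if_not_misaligned[OF u, of "1/100" \<sigma> \<sigma>'] \<tau>(2) by (simp add: d_def)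
      have 2: "(1 - (1/100)\<^sup>2) * (norm ?w)\<^sup>2 \<le> (?w \<bullet> tang \<tau>)\<^sup>2"
        using chord_ge_if_not_misaligned[OF u, of "1/100" s t] \<tau> \<open>\<tau> \<in> {s..t}\<close> long by simp
      have const: "1 - (1/100)\<^sup>2 = (9999/10000 :: real)" by (simp add: power2_eq_square)
      have "?w \<bullet> ?w' = 0" using level by (simp add: inner_commute)
      then have "(norm ?w)\<^sup>2 * (norm ?w')\<^sup>2 \<le> 0"
        using bessel_two[OF u, of ?w ?w'] mult_right_mono[OF 1[unfolded const] zero_le_power2[of "norm ?w"]]
          mult_right_mono[OF 2[unfolded const] zero_le_power2[of "norm ?w'"]]
          mult.commute[of "(norm ?w)\<^sup>2" "(norm ?w')\<^sup>2"] by linarith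
      moreover have "0 < (norm ?w)\<^sup>2 * (norm ?w')\<^sup>2" using w d by (simp add: d_def)
      ultimately show False by linarith
    qed
  qed
  then have "emeasure lborel (closed_segment \<sigma> y) \<le> emeasure lborel ((?N \<inter> closed_segment \<sigma> y) \<union> misaligned (1/100) \<sigma> \<sigma>')"
    by (intro emeasure_mono_AE) auto
  moreover have "bounded (?N \<inter> closed_segment \<sigma> y \<union> misaligned (1/100) \<sigma> \<sigma>')"
    by (auto simp: misaligned_def intro: bounded_subset[OF bounded_closed_interval])
  ultimately have "measure lborel (closed_segment \<sigma> y) \<le> measure lborel ((?N \<inter> closed_segment \<sigma> y) \<union> misaligned (1/100) \<sigma> \<sigma>')"
    by (simp add: emeasure_lborel_bounded bounded_closed_segment)
  also have "\<dots> \<le> measure lborel (?N \<inter> closed_segment \<sigma> y) + measure lborel (misaligned (1/100) \<sigma> \<sigma>')"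
    by (rule measure_Un_le) auto
  also have "measure lborel (misaligned (1/100) \<sigma> \<sigma>') \<le> 1/100 * d"
    unfolding d_def using \<sigma> d(2) x \<open>\<Gamma> \<sigma> \<noteq> \<Gamma> \<sigma>'\<close>
    by (intro measure_misaligned_le[where x = "t - s"]) (auto simp: d_def)
  also have "measure lborel (closed_segment \<sigma> y) = d"
    using y d by (auto simp: closed_segment_eq_real_ivl)
  finally have "d / 2 \<le> measure lborel (?N \<inter> closed_segment \<sigma> y)" using d by simp
  then show ?thesis using y by metis
qed

text \<open>
  If the height decreased at \<open>\<sigma>\<close> although no other point has the height of \<open>\<sigma>\<close>, then by the
  intermediate value theorem the curve would stay below that height afterwards and above it
  before.
\<close>

lemma tang_forward_if_levels_simple:
  assumes \<sigma>: "s < \<sigma>" "\<sigma> < t" "regular \<sigma>" and st: "\<Gamma> s \<bullet> w \<le> \<Gamma> t \<bullet> w"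
    and simple: "\<And>y. y \<in> {s..t} \<Longrightarrow> y \<noteq> \<sigma> \<Longrightarrow> \<Gamma> y \<bullet> w \<noteq> \<Gamma> \<sigma> \<bullet> w"
  shows "0 \<le> tang \<sigma> \<bullet> w"
proof (rule ccontr)
  let ?g = "\<lambda>x. \<Gamma> x \<bullet> w"
  assume "\<not> 0 \<le> tang \<sigma> \<bullet> w"
  then have neg: "tang \<sigma> \<bullet> w < 0" by simp
  have cont: "continuous_on A ?g" for A by (intro continuous_intros continuous)
  obtain e where e: "0 < e" "\<And>h. 0 < h \<Longrightarrow> h < e \<Longrightarrow> ?g (\<sigma> + h) < ?g \<sigma>"
    using DERIV_neg_dec_right[OF has_real_derivative_inner[OF \<sigma>(3)] neg] by blast
  obtain e' where e': "0 < e'" "\<And>h. 0 < h \<Longrightarrow> h < e' \<Longrightarrow> ?g \<sigma> < ?g (\<sigma> - h)"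
    using DERIV_neg_dec_left[OF has_real_derivative_inner[OF \<sigma>(3)] neg] by blast
  have "?g t < ?g \<sigma>"
  proof (rule ccontr)
    define y where "y = \<sigma> + min (e / 2) (t - \<sigma>)"
    assume "\<not> ?thesis"
    moreover have "?g y < ?g \<sigma>" "\<sigma> < y" "y \<le> t" using e \<sigma> by (auto simp: y_def min_def)
    ultimately obtain z where "y \<le> z" "z \<le> t" "?g z = ?g \<sigma>"
      using IVT'[of ?g y "?g \<sigma>" t] cont by fastforce
    then show False using simple[of z] \<sigma> \<open>\<sigma> < y\<close> by auto
  qed
  moreover have "?g \<sigma> < ?g s"
  proof (rule ccontr)
    define y where "y = \<sigma> - min (e' / 2) (\<sigma> - s)"
    assume "\<not> ?thesis"
    moreover have "?g \<sigma> < ?g y" "y < \<sigma>" "s \<le> y" using e' \<sigma> by (auto simp: y_def min_def)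
    ultimately obtain z where "s \<le> z" "z \<le> y" "?g z = ?g \<sigma>"
      using IVT'[of ?g s "?g \<sigma>" y] cont by fastforce
    then show False using simple[of z] \<sigma> \<open>y < \<sigma>\<close> by auto
  qed
  ultimately show False using st by simp
qed

text \<open>
  Off a set of measure at most \<open>11/100\<close> of the chord, the tangents are aligned with the chord and,
  since their heights are attained only once, point forward. Integrating them gives a chord that
  is nearly as long as the arc.
\<close>

lemma chord_ratio_gap:
  assumes "s < t" and x: "4 * (t - s) \<le> L" "C * (t - s) powr \<alpha> \<le> 1 / 100"
    and long: "t - s \<le> 2 * norm (\<Gamma> t - \<Gamma> s)"
  shows "3 / 4 * (t - s) \<le> norm (\<Gamma> t - \<Gamma> s)"
proof -
  let ?w = "\<Gamma> t - \<Gamma> s" and ?N = "misaligned (1/100) s t \<inter> {s..t}"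
  define d where "d = norm ?w"
  have d: "0 < d" "d \<le> t - s" using long \<open>s < t\<close> one_lipschitz[of t s] by (auto simp: d_def)
  have N: "?N \<in> sets borel" "bounded ?N"
    by (auto intro: bounded_subset[OF bounded_closed_interval])
  \<comment> \<open>\<open>U\<close> contains all parameters whose height may be attained elsewhere on the arc.\<close>
  obtain U where U: "U \<in> sets borel" "bounded U" "measure lborel U \<le> 10 * measure lborel ?N"
    and dense: "\<And>x y. \<lbrakk>x \<in> {s..t}; y \<in> {s..t}; x \<noteq> y; \<bar>x - y\<bar> / 2 \<le> measure lborel (?N \<inter> closed_segment x y)\<rbrakk> \<Longrightarrow> x \<in> U"
    using dense_points_cover[OF N, of s t] by blast
  note U(1)[measurable]
  define G where "G = {s<..<t} - U - ?N"
  have [measurable]: "G \<in> sets borel" by (auto simp: G_def)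
  have tang_G: "(1 - 1/100) * d \<le> tang \<sigma> \<bullet> ?w" if "\<sigma> \<in> G" "regular \<sigma>" for \<sigma>
  proof -
    have \<sigma>: "s < \<sigma>" "\<sigma> < t" "\<sigma> \<notin> U" "\<sigma> \<notin> misaligned (1/100) s t" using that by (auto simp: G_def)
    have "0 \<le> tang \<sigma> \<bullet> ?w"
    proof (rule tang_forward_if_levels_simple[OF \<sigma>(1,2) that(2)])
      have "0 \<le> ?w \<bullet> ?w" by simp
      then show "\<Gamma> s \<bullet> ?w \<le> \<Gamma> t \<bullet> ?w" by (simp add: inner_diff_left)
      fix y assume y: "y \<in> {s..t}" "y \<noteq> \<sigma>"
      show "\<Gamma> y \<bullet> ?w \<noteq> \<Gamma> \<sigma> \<bullet> ?w"
      proof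
        assume "\<Gamma> y \<bullet> ?w = \<Gamma> \<sigma> \<bullet> ?w"
        then have "(\<Gamma> y - \<Gamma> \<sigma>) \<bullet> ?w = 0" by (simp add: inner_diff_left)
        from half_misaligned_if_level[OF x long _ y(1) _ this] \<sigma> y
        obtain z where "z \<in> {s..t}" "\<sigma> \<noteq> z"
          "\<bar>\<sigma> - z\<bar> / 2 \<le> measure lborel (?N \<inter> closed_segment \<sigma> z)" by auto
        from dense[OF _ this] \<sigma> show False by auto
      qed
    qed
    moreover have "((1 - 1/100) * d)\<^sup>2 \<le> (tang \<sigma> \<bullet> ?w)\<^sup>2"
    proof -
      \<comment> \<open>Weakening the cosine to \<open>1 - 1/100\<close> avoids square roots.\<close>
      have "((1 - 1/100) * d)\<^sup>2 \<le> (1 - (1/100)\<^sup>2) * d\<^sup>2"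
        unfolding power_mult_distrib by (intro mult_right_mono) (auto simp: power2_eq_square)
      also have "\<dots> \<le> (tang \<sigma> \<bullet> ?w)\<^sup>2"
        using chord_ge_if_not_misaligned[of \<sigma> "1/100" s t] \<sigma> that long
        by (simp add: d_def regular_def inner_commute)
      finally show ?thesis .
    qed
    ultimately show ?thesis using power2_le_imp_le by blast
  qed
  have ww: "?w \<bullet> ?w = d * d" by (simp add: d_def dot_square_norm power2_eq_square)
  have "?w \<bullet> (- ?w) \<le> - ((1 - 1/100) * d) * measure lborel G + d * (t - s - measure lborel G)"
  proof (rule inner_increment_le)
    show "tang x \<bullet> - ?w \<le> - ((1 - 1/100) * d)" if "x \<in> G" "regular x" for x
      using tang_G[OF that] by (simp only: inner_minus_right neg_le_iff_le)
    show "tang x \<bullet> - ?w \<le> d" if "regular x" for x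
      using norm_cauchy_schwarz[of "tang x" "- ?w"] that by (simp add: regular_def d_def norm_minus_commute)
  qed (use \<open>s < t\<close> in \<open>auto simp: G_def\<close>)
  then have "(1 - 1/100) * d * measure lborel G - d * (t - s - measure lborel G) \<le> d * d"
    unfolding inner_minus_right ww by (simp add: algebra_simps)
  then have "d * ((1 - 1/100) * measure lborel G - (t - s - measure lborel G)) \<le> d * d"
    by (simp add: algebra_simps)
  then have 1: "(1 - 1/100) * measure lborel G - (t - s - measure lborel G) \<le> d"
    using d by (simp add: mult_le_cancel_left_pos)
  have "measure lborel ?N \<le> measure lborel (misaligned (1/100) s t)"
    by (intro measure_lborel_mono bounded_misaligned) auto
  also have "\<dots> \<le> 1/100 * d"
    unfolding d_def using d x by (intro measure_misaligned_le[where x = "t - s"]) (auto simp: d_def)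
  finally have 2: "measure lborel ?N \<le> 1/100 * d" .
  have "t - s = measure lborel {s<..<t}" using \<open>s < t\<close> by simp
  also have "\<dots> \<le> measure lborel (G \<union> (U \<union> ?N))"
  proof (rule measure_lborel_mono)
    have "bounded G" by (rule bounded_subset[OF bounded_closed_interval[of s t]]) (auto simp: G_def)
    then show "bounded (G \<union> (U \<union> ?N))" using U(2) N(2) by (simp only: bounded_Un)
  qed (auto simp: G_def)
  also have "\<dots> \<le> measure lborel G + (measure lborel U + measure lborel ?N)"
    by (intro order_trans[OF measure_Un_le] add_left_mono measure_Un_le) auto
  finally have 3: "t - s \<le> measure lborel G + 11/100 * d" using U(3) 2 by simp
  show ?thesis using 1 3 d unfolding d_def[symmetric] by simp
qed

text \<open>
  The threshold \<open>1 / 100\<close> for the alignment error leaves enough room in all the measure estimates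
  below.
\<close>

definition small_scale :: "real \<Rightarrow> bool" where
  "small_scale x \<longleftrightarrow> 0 < x \<and> 4 * x \<le> L \<and> C * x powr \<alpha> \<le> 1 / 100"

lemma small_scale_mono:
  assumes "small_scale x" "0 < y" "y \<le> x"
  shows "small_scale y"
proof -
  have "C * y powr \<alpha> \<le> C * x powr \<alpha>"
    using C_pos \<alpha>_pos assms by (intro mult_left_mono powr_mono2) auto
  then show ?thesis using assms by (simp add: small_scale_def)
qed

text \<open>
  The ratio of chord to arc avoids the interval \<open>[1/2, 3/4)\<close> by \<open>chord_ratio_gap\<close>, depends
  continuously on the arc, and exceeds \<open>1/2\<close> for very short arcs at a regular point. As the set of
  arcs is connected, it lies above the gap throughout.
\<close>

lemma chord_arc:
  assumes \<rho>: "small_scale \<rho>" and st: "s < t" "t - s \<le> \<rho>"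
  shows "3 / 4 * (t - s) \<le> norm (\<Gamma> t - \<Gamma> s)"
proof (rule ccontr)
  assume short: "\<not> ?thesis"
  define f where "f p = norm (\<Gamma> (fst p + snd p) - \<Gamma> (fst p)) / snd p" for p :: "real \<times> real"
  let ?S = "(UNIV :: real set) \<times> {0<..\<rho>}"
  have gap: "f (a, h) < 1 / 2 \<or> 3 / 4 \<le> f (a, h)" if "h \<in> {0<..\<rho>}" for a h
  proof -
    have h: "small_scale h" using small_scale_mono[OF \<rho>] that by simp
    have "h \<le> 2 * norm (\<Gamma> (a + h) - \<Gamma> a) \<Longrightarrow> 3 / 4 * h \<le> norm (\<Gamma> (a + h) - \<Gamma> a)"
      using chord_ratio_gap[of a "a + h"] h by (simp add: small_scale_def)
    then show ?thesis
      using that by (cases "h \<le> 2 * norm (\<Gamma> (a + h) - \<Gamma> a)") (auto simp: f_def field_simps)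
  qed
  obtain \<tau> where \<tau>: "regular \<tau>" using ex_regular[of 0 1] by auto
  have "((\<lambda>h. norm ((\<Gamma> (\<tau> + h) - \<Gamma> \<tau>) /\<^sub>R h)) \<longlongrightarrow> 1) (at_right 0)"
    using tendsto_norm[OF slope_tendsto, of \<Gamma> "tang \<tau>" \<tau>] \<tau>
    by (auto simp: regular_def intro: tendsto_mono[OF at_le])
  then have "\<forall>\<^sub>F h in at_right 0. 1 / 2 < norm ((\<Gamma> (\<tau> + h) - \<Gamma> \<tau>) /\<^sub>R h)"
    by (rule order_tendstoD) simp
  moreover have "\<forall>\<^sub>F h in at_right 0. h \<in> {0<..\<rho>}"
    using \<rho> by (auto simp: small_scale_def eventually_at_right_field intro!: exI[of _ \<rho>])
  ultimately have "\<forall>\<^sub>F h in at_right 0. h \<in> {0<..\<rho>} \<and> 1 / 2 < norm ((\<Gamma> (\<tau> + h) - \<Gamma> \<tau>) /\<^sub>R h)"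
    by eventually_elim auto
  from eventually_happens'[OF trivial_limit_at_right_real this]
  obtain h where h: "h \<in> {0<..\<rho>}" "1 / 2 < norm ((\<Gamma> (\<tau> + h) - \<Gamma> \<tau>) /\<^sub>R h)"
    by blast
  have high: "3 / 4 \<le> f (\<tau>, h)"
  proof -
    have "norm ((\<Gamma> (\<tau> + h) - \<Gamma> \<tau>) /\<^sub>R h) = f (\<tau>, h)"
      using h(1) by (simp add: f_def divide_inverse mult.commute)
    then show ?thesis using gap[OF h(1), of \<tau>] h(2) by linarith
  qed
  have "f (s, t - s) < 3 / 4" using short st by (simp add: f_def field_simps)
  then have low: "f (s, t - s) < 1 / 2" using gap[of "t - s" s] st by auto
  have "continuous_on ?S f"
    unfolding f_def by (intro continuous_intros continuous_on_compose2[OF continuous[of UNIV]]) auto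
  then have "connected (f ` ?S)"
    by (rule connected_continuous_image) (intro connected_Times, auto)
  moreover have "f (s, t - s) \<in> f ` ?S" "f (\<tau>, h) \<in> f ` ?S" using st h by auto
  ultimately have "3 / 5 \<in> f ` ?S"
  proof (rule connectedD_interval)
    show "f (s, t - s) \<le> 3 / 5" "3 / 5 \<le> f (\<tau>, h)" using low high by auto
  qed
  then obtain a x where "x \<in> {0<..\<rho>}" "f (a, x) = 3 / 5" by force
  then show False using gap[of x a] by simp
qed

end

section \<open>The modulus of continuity of the tangent\<close>

context aligned_loop
begin

definition chord_dir :: "real \<Rightarrow> real \<Rightarrow> real^3" where
  "chord_dir s t = sgn (\<Gamma> t - \<Gamma> s)"

text \<open>
  Unlike \<open>misaligned\<close>, this takes the orientation of the tangent into account.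
\<close>

definition turned :: "real \<Rightarrow> real \<Rightarrow> real set" where
  "turned s t = {\<tau> \<in> {s..t}. 2 * (C * (t - s) powr \<alpha>) < norm (tang \<tau> - chord_dir s t)}"

lemma turned_borel [measurable]: "turned s t \<in> sets borel"
  unfolding turned_def by measurable

lemma bounded_turned: "bounded (turned s t)"
  by (rule bounded_subset[OF bounded_closed_interval]) (auto simp: turned_def)

text \<open>
  Tangents aligned with the chord but pointing backwards shorten the chord, so by \<open>chord_arc\<close> they
  occupy at most a quarter of the interval.
\<close>

lemma measure_turned_le:
  assumes "s < t" and x: "small_scale (t - s)"
  shows "measure lborel (turned s t) \<le> 26 / 100 * (t - s)"
proof -
  define d w \<epsilon> where "d = norm (\<Gamma> t - \<Gamma> s)" and "w = \<Gamma> t - \<Gamma> s" and "\<epsilon> = C * (t - s) powr \<alpha>"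
  have \<epsilon>: "0 \<le> \<epsilon>" "\<epsilon> \<le> 1 / 100" using x C_pos by (auto simp: \<epsilon>_def small_scale_def)
  have d: "3 / 4 * (t - s) \<le> d" "d \<le> t - s" "0 < d"
    using chord_arc[OF x \<open>s < t\<close>] one_lipschitz[of t s] \<open>s < t\<close> by (auto simp: d_def)
  have ww: "w \<bullet> w = d * d" by (simp add: w_def d_def dot_square_norm power2_eq_square)
  define P where "P = {\<tau> \<in> {s..t}. tang \<tau> \<bullet> w \<le> 0}"
  have [measurable]: "P \<in> sets borel" unfolding P_def by measurable
  have P: "bounded P" by (rule bounded_subset[OF bounded_closed_interval]) (auto simp: P_def)
  have "(\<Gamma> t - \<Gamma> s) \<bullet> w \<le> 0 * measure lborel P + d * (t - s - measure lborel P)"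
  proof (rule inner_increment_le)
    show "tang x \<bullet> w \<le> d" if "regular x" for x
      using norm_cauchy_schwarz[of "tang x" w] that by (simp add: regular_def d_def w_def)
  qed (use \<open>s < t\<close> in \<open>auto simp: P_def\<close>)
  then have "d * d \<le> d * (t - s - measure lborel P)" unfolding w_def[symmetric] ww by simp
  then have mP: "measure lborel P \<le> 1 / 4 * (t - s)" using d by (simp add: mult_le_cancel_left_pos)
  have "AE \<tau> in lborel. \<tau> \<in> turned s t \<longrightarrow> \<tau> \<in> P \<union> misaligned \<epsilon> s t"
    using AE_regular
  proof eventually_elim
    case (elim \<tau>)
    then have u: "norm (tang \<tau>) = 1" by (simp add: regular_def)
    show ?case
    proof (intro impI, rule ccontr)
      assume \<tau>: "\<tau> \<in> turned s t" "\<tau> \<notin> P \<union> misaligned \<epsilon> s t"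
      define c where "c = tang \<tau> \<bullet> w / d"
      have "0 < c" using \<tau> d by (auto simp: turned_def P_def c_def)
      have "(1 - \<epsilon>\<^sup>2) * d\<^sup>2 \<le> (w \<bullet> tang \<tau>)\<^sup>2"
        unfolding d_def w_def
        by (rule chord_ge_if_not_misaligned[OF u]) (use \<tau> d \<epsilon> in \<open>auto simp: turned_def d_def\<close>)
      then have "1 - \<epsilon>\<^sup>2 \<le> c * c"
        using d by (simp add: c_def inner_commute power2_eq_square field_simps)
      moreover have "c \<le> 1"
        using norm_cauchy_schwarz[of "tang \<tau>" w] u d by (simp add: c_def d_def w_def)
      ultimately have c: "1 - \<epsilon>\<^sup>2 \<le> c" using \<open>0 < c\<close> mult_right_mono[of c 1 c] by linarith
      have v: "chord_dir s t = w /\<^sub>R d" "norm (chord_dir s t) = 1"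
        using d by (auto simp: chord_dir_def sgn_div_norm w_def d_def)
      have "(norm (tang \<tau> - chord_dir s t))\<^sup>2 = 2 - 2 * (tang \<tau> \<bullet> chord_dir s t)"
        unfolding power2_norm_eq_inner inner_diff_left inner_diff_right
        using u v(2) by (simp add: dot_square_norm inner_commute)
      also have "\<dots> = 2 - 2 * c" by (simp add: v(1) c_def divide_inverse)
      also have "\<dots> \<le> 4 * \<epsilon>\<^sup>2" using c zero_le_power2[of \<epsilon>] by linarith
      also have "\<dots> = (2 * \<epsilon>)\<^sup>2" by (simp add: power_mult_distrib)
      finally have "norm (tang \<tau> - chord_dir s t) \<le> 2 * \<epsilon>"
        by (rule power2_le_imp_le) (use \<epsilon> in simp)
      then show False using \<tau> by (auto simp: turned_def \<epsilon>_def)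
    qed
  qed
  then have "emeasure lborel (turned s t) \<le> emeasure lborel (P \<union> misaligned \<epsilon> s t)"
    by (intro emeasure_mono_AE) auto
  then have "measure lborel (turned s t) \<le> measure lborel (P \<union> misaligned \<epsilon> s t)"
    by (simp add: emeasure_lborel_bounded bounded_turned bounded_misaligned P)
  also have "\<dots> \<le> measure lborel P + measure lborel (misaligned \<epsilon> s t)"
    by (rule measure_Un_le) auto
  also have "measure lborel (misaligned \<epsilon> s t) \<le> \<epsilon> * d"
    unfolding d_def using d x by (intro measure_misaligned_le[where x = "t - s"])
      (auto simp: d_def \<epsilon>_def small_scale_def)
  also have "\<epsilon> * d \<le> 1 / 100 * (t - s)" using \<epsilon> d by (intro mult_mono) auto
  finally show ?thesis using mP by linarith
qed

text \<open>
  At most \<open>26/100\<close> of either interval is turned. In terms of the smaller interval this is at most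
  \<open>52/100\<close> plus \<open>26/100\<close> of its length, so both chords are close to a common tangent inside it.
\<close>

lemma chord_dir_close:
  assumes "s \<le> s'" "s' < t'" "t' \<le> t" "t - s \<le> 2 * (t' - s')" and x: "small_scale (t - s)"
  shows "norm (chord_dir s t - chord_dir s' t') \<le> 4 * (C * (t - s) powr \<alpha>)"
proof -
  have x': "small_scale (t' - s')" using small_scale_mono[OF x] assms by simp
  have "\<exists>\<tau>\<in>{s'..t'}. \<tau> \<notin> turned s t \<union> turned s' t'"
  proof (rule ccontr)
    assume "\<not> ?thesis"
    then have "measure lborel {s'..t'} \<le> measure lborel (turned s t \<union> turned s' t')"
      by (intro measure_lborel_mono) (auto simp: bounded_turned)
    also have "\<dots> \<le> measure lborel (turned s t) + measure lborel (turned s' t')"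
      by (rule measure_Un_le) auto
    finally show False
      using measure_turned_le[OF _ x] measure_turned_le[OF _ x'] assms by simp
  qed
  then obtain \<tau> where \<tau>: "\<tau> \<in> {s'..t'}" "\<tau> \<notin> turned s t" "\<tau> \<notin> turned s' t'" by blast
  have "C * (t' - s') powr \<alpha> \<le> C * (t - s) powr \<alpha>"
    using C_pos \<alpha>_pos assms by (intro mult_left_mono powr_mono2) auto
  then have "norm (tang \<tau> - chord_dir s t) \<le> 2 * (C * (t - s) powr \<alpha>)"
    "norm (tang \<tau> - chord_dir s' t') \<le> 2 * (C * (t - s) powr \<alpha>)"
    using \<tau> assms by (auto simp: turned_def)
  then show ?thesis
    using norm_triangle_ineq4[of "tang \<tau> - chord_dir s' t'" "tang \<tau> - chord_dir s t"] by simp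
qed

text \<open>
  The chord directions over \<open>[\<tau>, \<tau> + x / 2 ^ n]\<close> converge to the tangent at \<open>\<tau>\<close>, and consecutive
  ones differ by at most \<open>4 C x\<^sup>\<alpha> r ^ n\<close> with \<open>r = 2 powr - \<alpha> < 1\<close>.
\<close>

lemma tang_near_chord_dir:
  assumes \<tau>: "regular \<tau>" and x: "small_scale x"
  shows "norm (chord_dir \<tau> (\<tau> + x) - tang \<tau>) \<le> 4 / (1 - 2 powr - \<alpha>) * (C * x powr \<alpha>)"
proof -
  define r where "r = 2 powr - \<alpha>"
  have r: "0 < r" "r < 1" using \<alpha>_pos by (auto simp: r_def powr_less_one)
  define D where "D n = chord_dir \<tau> (\<tau> + x / 2 ^ n)" for n :: nat
  let ?A = "4 * (C * x powr \<alpha>)"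
  have x0: "0 < x" using x by (simp add: small_scale_def)
  have step: "norm (D n - D (Suc n)) \<le> ?A * r ^ n" for n
  proof -
    have "x / 2 ^ n \<le> x" using x0 by (simp add: divide_le_eq mult_le_cancel_left1)
    then have "small_scale (x / 2 ^ n)" using small_scale_mono[OF x] x0 by simp
    moreover have "x / 2 ^ Suc n \<le> x / 2 ^ n" using x0 by (simp add: field_simps)
    ultimately have "norm (D n - D (Suc n)) \<le> 4 * (C * (x / 2 ^ n) powr \<alpha>)"
      using chord_dir_close[of \<tau> \<tau> "\<tau> + x / 2 ^ Suc n" "\<tau> + x / 2 ^ n"] x0 by (simp add: D_def)
    also have "(x / 2 ^ n) powr \<alpha> = x powr \<alpha> * r ^ n"
      using x0 by (simp add: r_def powr_divide powr_minus_divide powr_realpow[symmetric] powr_powr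
        power_divide powr_power mult.commute)
    finally show ?thesis by (simp add: mult_ac)
  qed
  have sum: "norm (D 0 - D n) \<le> ?A * ((1 - r ^ n) / (1 - r))" for n
  proof (induction n)
    case (Suc n)
    have "norm (D 0 - D (Suc n)) \<le> norm (D 0 - D n) + norm (D n - D (Suc n))"
      using norm_triangle_ineq[of "D 0 - D n" "D n - D (Suc n)"] by simp
    also have "\<dots> \<le> ?A * ((1 - r ^ n) / (1 - r)) + ?A * r ^ n" by (intro add_mono Suc step)
    also have "\<dots> = ?A * ((1 - r ^ Suc n) / (1 - r))" using r by (simp add: field_simps)
    finally show ?case .
  qed simp
  have bound: "norm (D 0 - D n) \<le> 4 / (1 - r) * (C * x powr \<alpha>)" for n
  proof -
    have "(1 - r ^ n) / (1 - r) \<le> 1 / (1 - r)" using r by (intro divide_right_mono) auto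
    then have "?A * ((1 - r ^ n) / (1 - r)) \<le> ?A * (1 / (1 - r))"
      using C_pos by (intro mult_left_mono) auto
    then show ?thesis using sum[of n] by simp
  qed
  have "D \<longlonglongrightarrow> sgn (tang \<tau>)"
  proof -
    have "(\<lambda>n. x / 2 ^ n) \<longlonglongrightarrow> 0"
      using tendsto_mult[OF tendsto_const[of x] LIMSEQ_inverse_realpow_zero[of 2]]
      by (simp add: divide_inverse)
    then have "filterlim (\<lambda>n. x / 2 ^ n) (at 0) sequentially"
      using x0 by (auto simp: filterlim_at intro!: always_eventually)
    then have "(\<lambda>n. (\<Gamma> (\<tau> + x / 2 ^ n) - \<Gamma> \<tau>) /\<^sub>R (x / 2 ^ n)) \<longlonglongrightarrow> tang \<tau>"
      using \<tau> by (intro filterlim_compose[OF slope_tendsto]) (auto simp: regular_def)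
    then have "(\<lambda>n. sgn ((\<Gamma> (\<tau> + x / 2 ^ n) - \<Gamma> \<tau>) /\<^sub>R (x / 2 ^ n))) \<longlonglongrightarrow> sgn (tang \<tau>)"
      using \<tau> by (intro tendsto_sgn) (auto simp: regular_def)
    then show ?thesis using x0 by (simp add: D_def[abs_def] chord_dir_def sgn_scaleR)
  qed
  then have "(\<lambda>n. norm (D 0 - D n)) \<longlonglongrightarrow> norm (D 0 - sgn (tang \<tau>))"
    by (intro tendsto_intros)
  then have "norm (D 0 - sgn (tang \<tau>)) \<le> 4 / (1 - r) * (C * x powr \<alpha>)"
    by (rule LIMSEQ_le_const2) (use bound in blast)
  then show ?thesis using \<tau> by (simp add: D_def r_def regular_def sgn_div_norm)
qed

definition turn_const :: real where
  "turn_const = 8 / (1 - 2 powr - \<alpha>) + 8"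

text \<open>
  The chord over \<open>[\<tau>', \<tau> + x]\<close> is compared with those over \<open>[\<tau>, \<tau> + x]\<close> and \<open>[\<tau>', \<tau>' + x]\<close>, each
  of which is at most twice as long.
\<close>

lemma tang_modulus:
  assumes \<tau>: "regular \<tau>" "regular \<tau>'" "\<bar>\<tau> - \<tau>'\<bar> \<le> x / 2" and x: "small_scale x"
  shows "norm (tang \<tau> - tang \<tau>') \<le> turn_const * (C * x powr \<alpha>)"
proof -
  have *: "norm (tang \<tau> - tang \<tau>') \<le> turn_const * (C * x powr \<alpha>)"
    if \<tau>: "regular \<tau>" "regular \<tau>'" "\<tau> \<le> \<tau>'" "\<tau>' - \<tau> \<le> x / 2" for \<tau> \<tau>'
  proof -
    let ?v = "chord_dir \<tau> (\<tau> + x)" and ?v' = "chord_dir \<tau>' (\<tau>' + x)" and ?m = "chord_dir \<tau>' (\<tau> + x)"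
    have x0: "0 < x" using x by (simp add: small_scale_def)
    have "norm (?v - ?m) \<le> 4 * (C * x powr \<alpha>)" "norm (?v' - ?m) \<le> 4 * (C * x powr \<alpha>)"
      using chord_dir_close[of \<tau> \<tau>' "\<tau> + x" "\<tau> + x"] chord_dir_close[of \<tau>' \<tau>' "\<tau> + x" "\<tau>' + x"] \<tau> x x0 by auto
    moreover have "norm (tang \<tau> - tang \<tau>') \<le> norm (?v - ?m) + norm (?v' - ?m) + norm (?v - tang \<tau>) + norm (?v' - tang \<tau>')"
    proof -
      have "tang \<tau> - tang \<tau>' = (?v - ?m) - (?v' - ?m) - (?v - tang \<tau>) + (?v' - tang \<tau>')" by simp
      moreover have "norm (a - b - c + e) \<le> norm a + norm b + norm c + norm e" for a b c e :: "real^3"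
        using norm_triangle_ineq[of "a - b - c" e] norm_triangle_ineq4[of "a - b" c] norm_triangle_ineq4[of a b]
        by linarith
      ultimately show ?thesis by (simp only:)
    qed
    moreover note tang_near_chord_dir[OF \<tau>(1) x] tang_near_chord_dir[OF \<tau>(2) x]
    moreover have "turn_const * (C * x powr \<alpha>)
        = 2 * (4 / (1 - 2 powr - \<alpha>) * (C * x powr \<alpha>)) + 2 * (4 * (C * x powr \<alpha>))"
      by (simp add: turn_const_def distrib_right)
    ultimately show ?thesis by linarith
  qed
  show ?thesis
    using *[of \<tau> \<tau>'] *[of \<tau>' \<tau>] \<tau> by (cases "\<tau> \<le> \<tau>'") (auto simp: norm_minus_commute)
qed

end

section \<open>Uniform bi-Lipschitz bounds\<close>

context aligned_loop
begin

text \<open>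
  Consider a pair of points at minimal distance among those whose parameters are at least \<open>\<rho>\<close>
  apart on the circle. If the distance is below \<open>\<rho> / 8\<close>, then the pair is not at the boundary of
  that constraint, by \<open>chord_arc\<close>. By alignment some tangent near the first point is almost
  parallel to the chord, by \<open>tang_modulus\<close> so are all others nearby, and therefore moving the
  first point one way or the other decreases the distance.
\<close>

lemma far_apart:
  assumes \<rho>: "small_scale \<rho>" and turn: "turn_const * (C * \<rho> powr \<alpha>) \<le> 1 / 10"
    and st: "\<rho> \<le> t - s" "t - s \<le> L - \<rho>"
  shows "\<rho> / 8 \<le> norm (\<Gamma> t - \<Gamma> s)"
proof -
  define F where "F p = norm (\<Gamma> (fst p + snd p) - \<Gamma> (fst p))" for p :: "real \<times> real"
  have \<rho>0: "0 < \<rho>" "4 * \<rho> \<le> L" using \<rho> by (auto simp: small_scale_def)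
  have "continuous_on ({0..L} \<times> {\<rho>..L - \<rho>}) F"
    unfolding F_def by (intro continuous_intros continuous_on_compose2[OF continuous[of UNIV]]) auto
  moreover have "compact ({0..L} \<times> {\<rho>..L - \<rho>})" "{0..L} \<times> {\<rho>..L - \<rho>} \<noteq> {}"
    using \<rho>0 by (auto intro: compact_Times)
  ultimately obtain p where p: "p \<in> {0..L} \<times> {\<rho>..L - \<rho>}"
    "\<And>p'. p' \<in> {0..L} \<times> {\<rho>..L - \<rho>} \<Longrightarrow> F p \<le> F p'"
    using continuous_attains_inf by metis
  define s0 t0 d where "s0 = fst p" and "t0 = fst p + snd p" and "d = norm (\<Gamma> t0 - \<Gamma> s0)"
  have range0: "\<rho> \<le> t0 - s0" "t0 - s0 \<le> L - \<rho>" using p(1) by (auto simp: s0_def t0_def)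
  have min: "d \<le> norm (\<Gamma> b - \<Gamma> a)" if "\<rho> \<le> b - a" "b - a \<le> L - \<rho>" for a b
  proof -
    define k where "k = - \<lfloor>a / L\<rfloor>"
    have "of_int \<lfloor>a / L\<rfloor> * L \<le> a" "a < (of_int \<lfloor>a / L\<rfloor> + 1) * L"
      using L_pos by (simp_all add: pos_le_divide_eq[symmetric] pos_divide_less_eq[symmetric])
    then have "a + of_int k * L \<in> {0..L}" by (simp add: k_def algebra_simps)
    then have "F p \<le> F (a + of_int k * L, b - a)" using that by (intro p(2)) auto
    also have "\<dots> = norm (\<Gamma> b - \<Gamma> a)"
      using periodic_int[of a k] periodic_int[of b k] by (simp add: F_def add_ac)
    finally show ?thesis by (simp add: d_def s0_def t0_def F_def)
  qed
  have "\<rho> / 8 \<le> d"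
  proof (rule ccontr)
    assume "\<not> ?thesis"
    then have d8: "d < \<rho> / 8" by simp
    have neq: "\<Gamma> s0 \<noteq> \<Gamma> t0" using neq_if_close[of s0 t0] range0 \<rho>0 by auto
    then have d: "0 < d" by (simp add: d_def)
    have "t0 - s0 \<noteq> \<rho>" using chord_arc[OF \<rho>, of s0 t0] \<rho>0 d8 by (auto simp: d_def)
    moreover have "t0 - s0 \<noteq> L - \<rho>"
      using chord_arc[OF \<rho>, of t0 "s0 + L"] \<rho>0 d8 range0 by (auto simp: d_def periodic norm_minus_commute)
    ultimately have strict: "\<rho> < t0 - s0" "t0 - s0 < L - \<rho>" using range0 by auto
    let ?w = "\<Gamma> t0 - \<Gamma> s0"
    have "\<exists>\<tau>\<in>{s0..s0 + 2 * d}. regular \<tau> \<and> \<tau> \<notin> misaligned (1/100) s0 t0"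
    proof (rule ccontr)
      assume "\<not> ?thesis"
      then have "AE \<tau> in lborel. \<tau> \<in> {s0..s0 + 2 * d} \<longrightarrow> \<tau> \<in> misaligned (1/100) s0 t0"
        using AE_regular by (auto elim: eventually_mono)
      then have "emeasure lborel {s0..s0 + 2 * d} \<le> emeasure lborel (misaligned (1/100) s0 t0)"
        by (intro emeasure_mono_AE) auto
      then have "2 * d \<le> measure lborel (misaligned (1/100) s0 t0)"
        using d by (simp add: emeasure_lborel_bounded bounded_misaligned)
      also have "\<dots> \<le> 1/100 * d"
        unfolding d_def using neq \<rho> d8
        by (intro measure_misaligned_le[where x = \<rho>]) (auto simp: small_scale_def d_def)
      finally show False using d by simp
    qed
    then obtain \<tau> where \<tau>: "\<tau> \<in> {s0..s0 + 2 * d}" "regular \<tau>" "\<tau> \<notin> misaligned (1/100) s0 t0" by blast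
    have u: "norm (tang \<tau>) = 1" using \<tau> by (simp add: regular_def)
    have "(99/100 * d)\<^sup>2 \<le> (1 - (1/100)\<^sup>2) * d\<^sup>2"
      unfolding power_mult_distrib by (intro mult_right_mono) (auto simp: power2_eq_square)
    also have "\<dots> \<le> (?w \<bullet> tang \<tau>)\<^sup>2"
      unfolding d_def using chord_ge_if_not_misaligned[OF u \<tau>(3)] \<tau>(1) by (simp add: d_def)
    finally have big: "99/100 * d \<le> \<bar>?w \<bullet> tang \<tau>\<bar>"
      using d by (metis abs_le_square_iff abs_of_nonneg less_eq_real_def mult_nonneg_nonneg divide_nonneg_nonneg zero_le_numeral)
    \<comment> \<open>A step this short keeps the pair within the constraint, and within the range of the modulus of the tangent.\<close>
    define \<eta> where "\<eta> = min (min (\<rho> / 4) d) (min (t0 - s0 - \<rho>) (L - \<rho> - (t0 - s0)))"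
    have \<eta>: "0 < \<eta>" "\<eta> \<le> \<rho> / 4" "\<eta> \<le> d" "\<eta> \<le> t0 - s0 - \<rho>" "\<eta> \<le> L - \<rho> - (t0 - s0)"
      using \<rho>0 d strict by (auto simp: \<eta>_def min_def)
    define \<theta> where "\<theta> = (if 0 \<le> ?w \<bullet> tang \<tau> then \<eta> else - \<eta>)"
    let ?z = "\<Gamma> (s0 + \<theta>) - \<Gamma> s0"
    have close: "norm (tang y - tang \<tau>) \<le> 1 / 10" if "y \<in> {s0 - \<eta>..s0 + \<eta>}" "regular y" for y
    proof -
      have "\<bar>y - \<tau>\<bar> \<le> \<rho> / 2"
        using that(1) \<tau>(1) d8 \<eta>(2) unfolding abs_le_iff atLeastAtMost_iff by linarith
      from tang_modulus[OF that(2) \<tau>(2) this \<rho>] show ?thesis using turn by linarith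
    qed
    have "norm (?z - \<theta> *\<^sub>R tang \<tau>) \<le> 1 / 10 * \<eta>"
    proof (cases "0 \<le> ?w \<bullet> tang \<tau>")
      case True
      then show ?thesis
        using norm_increment_le_of_tang[of s0 "s0 + \<eta>" "tang \<tau>" "1/10"] close \<eta> by (simp add: \<theta>_def)
    next
      case False
      then show ?thesis
        using norm_increment_le_of_tang[of "s0 - \<eta>" s0 "tang \<tau>" "1/10"] close \<eta>
          norm_minus_commute[of "?z" "\<theta> *\<^sub>R tang \<tau>"] by (simp add: \<theta>_def algebra_simps)
    qed
    then have "d * norm (?z - \<theta> *\<^sub>R tang \<tau>) \<le> d * (1 / 10 * \<eta>)" using d by (intro mult_left_mono) auto
    then have "\<bar>?w \<bullet> (?z - \<theta> *\<^sub>R tang \<tau>)\<bar> \<le> 1 / 10 * (\<eta> * d)"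
      using Cauchy_Schwarz_ineq2[of ?w "?z - \<theta> *\<^sub>R tang \<tau>"] by (simp add: d_def mult_ac)
    moreover have "?w \<bullet> (?z - \<theta> *\<^sub>R tang \<tau>) = ?w \<bullet> ?z - \<theta> * (?w \<bullet> tang \<tau>)"
      by (metis inner_diff_right inner_scaleR_right)
    moreover have "\<theta> * (?w \<bullet> tang \<tau>) = \<eta> * \<bar>?w \<bullet> tang \<tau>\<bar>" by (simp add: \<theta>_def)
    moreover have "99 / 100 * (\<eta> * d) \<le> \<eta> * \<bar>?w \<bullet> tang \<tau>\<bar>"
      using mult_left_mono[OF big, of \<eta>] \<eta> by (simp add: mult_ac)
    moreover have "0 \<le> \<eta> * d" using \<eta> d by simp
    ultimately have wz: "8 / 10 * (\<eta> * d) \<le> ?w \<bullet> ?z" by linarith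
    have "norm ?z \<le> \<eta>" using one_lipschitz[of "s0 + \<theta>" s0] \<eta> by (simp add: \<theta>_def split: if_splits)
    then have "?z \<bullet> ?z \<le> \<eta> * \<eta>"
      using \<eta> by (simp add: dot_square_norm power2_eq_square mult_mono)
    also have "\<dots> \<le> \<eta> * d" using \<eta> by (intro mult_left_mono) auto
    finally have zz: "?z \<bullet> ?z \<le> \<eta> * d" .
    have "\<Gamma> t0 - \<Gamma> (s0 + \<theta>) = ?w - ?z" by simp
    then have "(norm (\<Gamma> t0 - \<Gamma> (s0 + \<theta>)))\<^sup>2 = ?w \<bullet> ?w - 2 * (?w \<bullet> ?z) + ?z \<bullet> ?z"
      unfolding power2_norm_eq_inner by (simp add: inner_diff_left inner_diff_right inner_commute)
    also have "\<dots> < ?w \<bullet> ?w" using wz zz \<eta> d mult_pos_pos[of \<eta> d] by linarith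
    also have "\<dots> = d\<^sup>2" by (simp add: d_def dot_square_norm)
    finally have "norm (\<Gamma> t0 - \<Gamma> (s0 + \<theta>)) < d" using d by (simp add: power_less_imp_less_base)
    moreover have "d \<le> norm (\<Gamma> t0 - \<Gamma> (s0 + \<theta>))"
      using \<eta> by (intro min) (auto simp: \<theta>_def)
    ultimately show False by simp
  qed
  also have "d \<le> norm (\<Gamma> t - \<Gamma> s)" by (rule min[OF st])
  finally show ?thesis .
qed

lemma bi_lipschitz:
  assumes \<rho>: "small_scale \<rho>" and turn: "turn_const * (C * \<rho> powr \<alpha>) \<le> 1 / 10"
    and st: "\<bar>t - s\<bar> \<le> L / 2"
  shows "\<rho> / (4 * L) * \<bar>t - s\<bar> \<le> norm (\<Gamma> t - \<Gamma> s)"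
proof -
  have \<rho>0: "0 < \<rho>" "4 * \<rho> \<le> L" using \<rho> by (auto simp: small_scale_def)
  have *: "\<rho> / (4 * L) * (t - s) \<le> norm (\<Gamma> t - \<Gamma> s)" if "s < t" "t - s \<le> L / 2" for s t
  proof (cases "t - s \<le> \<rho>")
    case True
    have "\<rho> / (4 * L) * (t - s) \<le> 3 / 4 * (t - s)"
      using \<rho>0 that L_pos by (intro mult_right_mono) (auto simp: field_simps)
    then show ?thesis using chord_arc[OF \<rho> that(1) True] by simp
  next
    case False
    have "\<rho> / (4 * L) * (t - s) \<le> \<rho> / (4 * L) * (L / 2)"
      using \<rho>0 L_pos that by (intro mult_left_mono) auto
    also have "\<dots> = \<rho> / 8" using L_pos by simp
    also have "\<dots> \<le> norm (\<Gamma> t - \<Gamma> s)" using False that \<rho>0 by (intro far_apart[OF \<rho> turn]) auto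
    finally show ?thesis .
  qed
  show ?thesis
    using *[of s t] *[of t s] st by (cases s t rule: linorder_cases) (auto simp: norm_minus_commute)
qed

end

section \<open>Finitely many codes\<close>

lemma ex_small_powr:
  fixes C \<alpha> \<epsilon> b :: real
  assumes "0 < C" "0 < \<alpha>" "0 < \<epsilon>" "0 < b"
  shows "\<exists>x>0. x \<le> b \<and> C * x powr \<alpha> \<le> \<epsilon>"
proof -
  define x where "x = min b ((\<epsilon> / C) powr (1 / \<alpha>))"
  have "0 < x" "x \<le> b" using assms by (auto simp: x_def)
  moreover have "x powr \<alpha> \<le> ((\<epsilon> / C) powr (1 / \<alpha>)) powr \<alpha>"
    using assms \<open>0 < x\<close> by (intro powr_mono2) (auto simp: x_def)
  then have "C * x powr \<alpha> \<le> \<epsilon>" using assms by (simp add: powr_powr field_simps)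
  ultimately show ?thesis by blast
qed

lemma piecewise_increment_le:
  fixes f :: "real \<Rightarrow> 'a::real_normed_vector"
  assumes "0 \<le> h"
    and "\<And>k a b. \<lbrakk>k < n; real k * h \<le> a; a \<le> b; b \<le> real (Suc k) * h\<rbrakk> \<Longrightarrow> norm (f b - f a) \<le> c * (b - a)"
    and "0 \<le> a" "a \<le> b" "b \<le> real n * h"
  shows "norm (f b - f a) \<le> c * (b - a)"
  using assms(2-)
proof (induction n arbitrary: a b)
  case (Suc n)
  have IH: "norm (f y - f x) \<le> c * (y - x)" if "0 \<le> x" "x \<le> y" "y \<le> real n * h" for x y
  proof (rule Suc.IH[OF _ that])
    fix k a b assume "k < n" "real k * h \<le> a" "a \<le> b" "b \<le> real (Suc k) * h"
    then show "norm (f b - f a) \<le> c * (b - a)" by (intro Suc.prems(1)[of k]) auto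
  qed
  have last: "norm (f y - f x) \<le> c * (y - x)" if "real n * h \<le> x" "x \<le> y" "y \<le> real (Suc n) * h" for x y
    using Suc.prems(1)[of n x y] that by simp
  consider "b \<le> real n * h" | "real n * h \<le> a" | "a \<le> real n * h" "real n * h \<le> b" by linarith
  then show ?case
  proof cases
    case 3
    have "norm (f b - f a) \<le> norm (f b - f (real n * h)) + norm (f (real n * h) - f a)"
      using norm_triangle_ineq[of "f b - f (real n * h)" "f (real n * h) - f a"] by simp
    also have "\<dots> \<le> c * (b - real n * h) + c * (real n * h - a)"
      using 3 Suc.prems by (intro add_mono IH last) auto
    finally show ?thesis by (simp add: algebra_simps)
  qed (use Suc.prems IH last in auto)
next
  case 0
  then have "a = b" by simp
  then show ?case by simp
qed

text \<open>
  Closeness of the two parametrizations is measured by the Lipschitz constant of their difference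
  over one period. Across the end of the period it extends to the circle because the difference
  takes the same value at \<open>0\<close> and \<open>L\<close>.
\<close>

lemma (in unit_speed_loop) ambient_isotopic_if_close:
  assumes \<Delta>: "unit_speed_loop L \<Delta>" and "0 < \<kappa>"
    and bilip: "\<And>s t. \<bar>t - s\<bar> \<le> L / 2 \<Longrightarrow> \<kappa> * \<bar>t - s\<bar> \<le> norm (\<Gamma> t - \<Gamma> s)"
    and close: "\<And>a b. \<lbrakk>0 \<le> a; a \<le> b; b \<le> L\<rbrakk> \<Longrightarrow> norm ((\<Delta> b - \<Gamma> b) - (\<Delta> a - \<Gamma> a)) \<le> c * (b - a)"
    and c: "0 \<le> c" "3 * c < \<kappa>"
  shows "ambient_isotopic (\<Gamma> ` {0..<L}) (\<Delta> ` {0..<L})"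
proof -
  define f where "f x = \<Delta> (inv_into {0..<L} \<Gamma> x)" for x
  define D where "D t = \<Delta> t - \<Gamma> t" for t
  have f: "f (\<Gamma> t) = \<Delta> t" if "t \<in> {0..<L}" for t
    using that inj by (simp add: f_def inv_into_f_f)
  have D_L: "D L = D 0"
    using periodic[of 0] unit_speed_loop.periodic[OF \<Delta>, of 0] by (simp add: D_def)
  have le: "norm (D t - D s) \<le> c / \<kappa> * norm (\<Gamma> t - \<Gamma> s)"
    if "s \<in> {0..<L}" "t \<in> {0..<L}" "s \<le> t" for s t
  proof (cases "t - s \<le> L / 2")
    case True
    have "norm (D t - D s) \<le> c * (t - s)" using close[of s t] that by (simp add: D_def)
    also have "\<dots> = c / \<kappa> * (\<kappa> * \<bar>t - s\<bar>)" using \<open>0 < \<kappa>\<close> that by simp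
    also have "\<dots> \<le> c / \<kappa> * norm (\<Gamma> t - \<Gamma> s)"
      using True that c \<open>0 < \<kappa>\<close> by (intro mult_left_mono bilip) auto
    finally show ?thesis .
  next
    case False
    have "norm (D t - D s) \<le> norm (D L - D t) + norm (D s - D 0)"
      using norm_triangle_ineq[of "D t - D L" "D 0 - D s"] D_L by (simp add: norm_minus_commute)
    also have "\<dots> \<le> c * (L - t) + c * (s - 0)"
      using close[of t L] close[of 0 s] that by (intro add_mono) (auto simp: D_def)
    also have "\<dots> = c / \<kappa> * (\<kappa> * \<bar>s + L - t\<bar>)"
      using \<open>0 < \<kappa>\<close> that by (simp add: algebra_simps)
    also have "\<dots> \<le> c / \<kappa> * norm (\<Gamma> (s + L) - \<Gamma> t)"
      using False that c \<open>0 < \<kappa>\<close> by (intro mult_left_mono bilip) auto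
    also have "\<dots> = c / \<kappa> * norm (\<Gamma> t - \<Gamma> s)" by (simp add: periodic norm_minus_commute)
    finally show ?thesis .
  qed
  have "(c / \<kappa>)-lipschitz_on (\<Gamma> ` {0..<L}) (\<lambda>x. f x - x)"
  proof (rule lipschitz_onI)
    fix x y assume "x \<in> \<Gamma> ` {0..<L}" "y \<in> \<Gamma> ` {0..<L}"
    then obtain s t where st: "x = \<Gamma> s" "y = \<Gamma> t" "s \<in> {0..<L}" "t \<in> {0..<L}" by blast
    then show "dist (f x - x) (f y - y) \<le> c / \<kappa> * dist x y"
      using le[of s t] le[of t s] f[of s] f[of t]
      by (cases "s \<le> t") (auto simp: dist_norm D_def norm_minus_commute)
  qed (use c \<open>0 < \<kappa>\<close> in simp)
  moreover have "c / \<kappa> < 1 / 3" using c \<open>0 < \<kappa>\<close> by (simp add: field_simps)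
  ultimately have "ambient_isotopic (\<Gamma> ` {0..<L}) (f ` \<Gamma> ` {0..<L})"
    by (rule ambient_isotopic_lipschitz_displacement)
  also have "f ` \<Gamma> ` {0..<L} = \<Delta> ` {0..<L}"
    unfolding image_image by (intro image_cong) (auto simp: f)
  finally show ?thesis .
qed

text \<open>
  On the \<open>k\<close>-th of \<open>n\<close> equal pieces of the period, \<open>\<Gamma>\<close> differs from a motion with constant
  velocity \<open>c k\<close> by a function with Lipschitz constant \<open>\<epsilon>\<close>. Nothing fixes the position of the
  curve in space.
\<close>

definition follows :: "real \<Rightarrow> nat \<Rightarrow> real \<Rightarrow> (nat \<Rightarrow> real^3) \<Rightarrow> (real \<Rightarrow> real^3) \<Rightarrow> bool" where
  "follows L n \<epsilon> c \<Gamma> \<longleftrightarrow> (\<forall>k<n. \<forall>a b. real k * (L / n) \<le> a \<longrightarrow> a \<le> b \<longrightarrow> b \<le> real (Suc k) * (L / n) \<longrightarrow>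
     norm (\<Gamma> b - \<Gamma> a - (b - a) *\<^sub>R c k) \<le> \<epsilon> * (b - a))"

lemma (in aligned_loop) ex_follows:
  assumes x: "small_scale x" "turn_const * (C * x powr \<alpha>) \<le> \<epsilon>"
    and n: "0 < n" "2 * L \<le> real n * x"
    and F: "sphere 0 1 \<subseteq> (\<Union>u\<in>F. ball u \<epsilon>)"
  shows "\<exists>c \<in> {..<n} \<rightarrow>\<^sub>E F. follows L n (2 * \<epsilon>) c \<Gamma>"
proof -
  have piece: "\<exists>u\<in>F. \<forall>a b. real k * (L / n) \<le> a \<longrightarrow> a \<le> b \<longrightarrow> b \<le> real (Suc k) * (L / n) \<longrightarrow>
      norm (\<Gamma> b - \<Gamma> a - (b - a) *\<^sub>R u) \<le> 2 * \<epsilon> * (b - a)" for k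
  proof -
    have "real k * (L / n) < real (Suc k) * (L / n)" using L_pos n by (simp add: field_simps)
    then obtain \<tau> where \<tau>: "\<tau> \<in> {real k * (L / n)..real (Suc k) * (L / n)}" "regular \<tau>"
      using ex_regular by blast
    then have "tang \<tau> \<in> sphere 0 1" by (simp add: regular_def)
    then obtain u where u: "u \<in> F" "norm (tang \<tau> - u) \<le> \<epsilon>"
      using F by (force simp: dist_norm norm_minus_commute)
    have Ln: "L / n \<le> x / 2" using n by (simp add: field_simps)
    have "norm (\<Gamma> b - \<Gamma> a - (b - a) *\<^sub>R u) \<le> 2 * \<epsilon> * (b - a)"
      if ab: "real k * (L / n) \<le> a" "a \<le> b" "b \<le> real (Suc k) * (L / n)" for a b
    proof (rule norm_increment_le_of_tang[OF \<open>a \<le> b\<close>])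
      fix y assume y: "y \<in> {a..b}" "regular y"
      have "real (Suc k) * (L / n) = real k * (L / n) + L / n" by (simp only: of_nat_Suc distrib_right mult_1_left add.commute)
      then have "\<bar>y - \<tau>\<bar> \<le> x / 2"
        using y(1) ab \<tau>(1) Ln unfolding abs_le_iff atLeastAtMost_iff by linarith
      from tang_modulus[OF y(2) \<tau>(2) this x(1)] have "norm (tang y - tang \<tau>) \<le> \<epsilon>"
        using x(2) by linarith
      then show "norm (tang y - u) \<le> 2 * \<epsilon>"
        using u(2) norm_triangle_ineq[of "tang y - tang \<tau>" "tang \<tau> - u"] by simp
    qed
    then show ?thesis using u(1) by blast
  qed
  then obtain c where c: "\<And>k. c k \<in> F" "\<And>k a b. real k * (L / n) \<le> a \<Longrightarrow> a \<le> b \<Longrightarrow> b \<le> real (Suc k) * (L / n) \<Longrightarrow>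
      norm (\<Gamma> b - \<Gamma> a - (b - a) *\<^sub>R c k) \<le> 2 * \<epsilon> * (b - a)"
    by metis
  have "restrict c {..<n} \<in> {..<n} \<rightarrow>\<^sub>E F" using c(1) by auto
  moreover have "follows L n (2 * \<epsilon>) (restrict c {..<n}) \<Gamma>"
    using c(2) by (auto simp: follows_def)
  ultimately show ?thesis by blast
qed

lemma ambient_isotopic_if_follow_same:
  assumes \<Gamma>: "aligned_loop L \<Gamma> C \<alpha>" and \<Delta>: "aligned_loop L \<Delta> C \<alpha>"
    and \<rho>: "aligned_loop.small_scale L C \<alpha> \<rho>" "aligned_loop.turn_const \<alpha> * (C * \<rho> powr \<alpha>) \<le> 1 / 10"
    and n: "0 < n" and \<epsilon>: "0 \<le> \<epsilon>" "6 * \<epsilon> < \<rho> / (4 * L)"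
    and c: "follows L n \<epsilon> c \<Gamma>" "follows L n \<epsilon> c \<Delta>"
  shows "ambient_isotopic (\<Gamma> ` {0..<L}) (\<Delta> ` {0..<L})"
proof -
  interpret \<Gamma>: aligned_loop L \<Gamma> C \<alpha> by (rule \<Gamma>)
  interpret \<Delta>: aligned_loop L \<Delta> C \<alpha> by (rule \<Delta>)
  let ?D = "\<lambda>t. \<Delta> t - \<Gamma> t"
  have close: "norm (?D b - ?D a) \<le> 2 * \<epsilon> * (b - a)" if "0 \<le> a" "a \<le> b" "b \<le> L" for a b
  proof (rule piecewise_increment_le[where h = "L / n" and n = n])
    fix k a b assume k: "k < n" "real k * (L / n) \<le> a" "a \<le> b" "b \<le> real (Suc k) * (L / n)"
    have "?D b - ?D a = (\<Delta> b - \<Delta> a - (b - a) *\<^sub>R c k) - (\<Gamma> b - \<Gamma> a - (b - a) *\<^sub>R c k)" by simp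
    then have "norm (?D b - ?D a)
        \<le> norm (\<Delta> b - \<Delta> a - (b - a) *\<^sub>R c k) + norm (\<Gamma> b - \<Gamma> a - (b - a) *\<^sub>R c k)"
      by (simp only: norm_triangle_ineq4)
    also have "\<dots> \<le> \<epsilon> * (b - a) + \<epsilon> * (b - a)"
      using c k unfolding follows_def by (intro add_mono) blast+
    finally show "norm (?D b - ?D a) \<le> 2 * \<epsilon> * (b - a)" by simp
  qed (use that n \<Gamma>.L_pos in auto)
  have "0 < \<rho>" using \<rho>(1) by (simp add: \<Gamma>.small_scale_def)
  show ?thesis
  proof (rule \<Gamma>.ambient_isotopic_if_close[OF \<Delta>.unit_speed_loop_axioms _ _ close])
    show "0 < \<rho> / (4 * L)" using \<open>0 < \<rho>\<close> \<Gamma>.L_pos by simp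
    show "\<rho> / (4 * L) * \<bar>t - s\<bar> \<le> norm (\<Gamma> t - \<Gamma> s)" if "\<bar>t - s\<bar> \<le> L / 2" for s t
      by (rule \<Gamma>.bi_lipschitz[OF \<rho> that])
  qed (use \<epsilon> in auto)
qed

text \<open>
  All constants come from \<open>L\<close>, \<open>C\<close> and \<open>\<alpha>\<close>, so one partition and one net of the unit sphere serve
  all loops, and the code of a representative determines its knot type.
\<close>

lemma finite_aligned_loop_knot_types:
  assumes pos: "0 < L" "0 < C" "0 < \<alpha>"
  shows "finite {K \<in> knot_types. \<exists>\<Gamma>. aligned_loop L \<Gamma> C \<alpha> \<and> \<Gamma> ` {0..<L} \<in> K}" (is "finite ?S")
proof (cases "?S = {}")
  case False
  then obtain \<Gamma>0 where "aligned_loop L \<Gamma>0 C \<alpha>" by blast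
  then interpret \<Gamma>0: aligned_loop L \<Gamma>0 C \<alpha> .
  define m where "m = \<bar>\<Gamma>0.turn_const\<bar> + 1"
  have m: "1 \<le> m" "\<Gamma>0.turn_const \<le> m" by (auto simp: m_def)
  have scale: "\<exists>x. \<Gamma>0.small_scale x \<and> \<Gamma>0.turn_const * (C * x powr \<alpha>) \<le> \<epsilon>" if "0 < \<epsilon>" for \<epsilon>
  proof -
    have "0 < \<epsilon> / m" using that m by simp
    then obtain x where x: "0 < x" "x \<le> L / 4" "C * x powr \<alpha> \<le> min (1 / 100) (\<epsilon> / m)"
      using ex_small_powr[OF pos(2,3), of "min (1 / 100) (\<epsilon> / m)" "L / 4"] pos that m by auto
    have "\<Gamma>0.turn_const * (C * x powr \<alpha>) \<le> m * (C * x powr \<alpha>)"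
      using m pos by (intro mult_right_mono) auto
    also have "\<dots> \<le> \<epsilon>" using x(3) m by (simp add: field_simps)
    finally show ?thesis using x by (auto simp: \<Gamma>0.small_scale_def)
  qed
  obtain \<rho> where \<rho>: "\<Gamma>0.small_scale \<rho>" "\<Gamma>0.turn_const * (C * \<rho> powr \<alpha>) \<le> 1 / 10"
    using scale[of "1 / 10"] by auto
  define \<kappa> where "\<kappa> = \<rho> / (4 * L)"
  have "0 < \<kappa>" using \<rho>(1) pos by (simp add: \<kappa>_def \<Gamma>0.small_scale_def)
  \<comment> \<open>Velocities within \<open>2 \<epsilon>\<close> of the code give a difference with Lipschitz constant \<open>4 \<epsilon>\<close>; three times that must stay below the bi-Lipschitz constant \<open>\<kappa>\<close>.\<close>
  define \<epsilon> where "\<epsilon> = \<kappa> / 16"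
  have \<epsilon>: "0 < \<epsilon>" "6 * (2 * \<epsilon>) < \<rho> / (4 * L)"
    using \<open>0 < \<kappa>\<close> by (simp_all add: \<epsilon>_def flip: \<kappa>_def)
  obtain x where x: "\<Gamma>0.small_scale x" "\<Gamma>0.turn_const * (C * x powr \<alpha>) \<le> \<epsilon>"
    using scale[OF \<epsilon>(1)] by auto
  obtain F where F: "finite F" "sphere (0 :: real^3) 1 \<subseteq> (\<Union>u\<in>F. ball u \<epsilon>)"
    using \<epsilon>(1) compact_sphere[of "0 :: real^3" 1] unfolding compact_eq_totally_bounded by blast
  obtain n where n: "2 * L < real n * x"
    using reals_Archimedean3[of x] x(1) by (auto simp: \<Gamma>0.small_scale_def)
  have n0: "0 < n" using n pos by (cases n) auto
  define coded where "coded K c \<longleftrightarrow> c \<in> {..<n} \<rightarrow>\<^sub>E F \<and>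
    (\<exists>\<Gamma>. aligned_loop L \<Gamma> C \<alpha> \<and> \<Gamma> ` {0..<L} \<in> K \<and> follows L n (2 * \<epsilon>) c \<Gamma>)" for K c
  define code where "code K = (SOME c. coded K c)" for K
  have code: "coded K (code K)" if "K \<in> ?S" for K
  proof -
    from that obtain \<Gamma> where \<Gamma>: "aligned_loop L \<Gamma> C \<alpha>" "\<Gamma> ` {0..<L} \<in> K" by blast
    then have "\<exists>c. coded K c"
      using aligned_loop.ex_follows[OF \<Gamma>(1) x n0 _ F(2)] n unfolding coded_def by auto
    then show ?thesis unfolding code_def by (rule someI_ex)
  qed
  have "inj_on code ?S"
  proof (rule inj_onI)
    fix K K' assume K: "K \<in> ?S" "K' \<in> ?S" and eq: "code K = code K'"
    obtain \<Gamma> where \<Gamma>: "aligned_loop L \<Gamma> C \<alpha>" "\<Gamma> ` {0..<L} \<in> K" "follows L n (2 * \<epsilon>) (code K) \<Gamma>"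
      using code[OF K(1)] unfolding coded_def by blast
    obtain \<Delta> where \<Delta>: "aligned_loop L \<Delta> C \<alpha>" "\<Delta> ` {0..<L} \<in> K'" "follows L n (2 * \<epsilon>) (code K) \<Delta>"
      using code[OF K(2)] unfolding coded_def eq by blast
    have iso: "ambient_isotopic (\<Gamma> ` {0..<L}) (\<Delta> ` {0..<L})"
      using \<epsilon> by (intro ambient_isotopic_if_follow_same[OF \<Gamma>(1) \<Delta>(1) \<rho> n0 _ _ \<Gamma>(3) \<Delta>(3)]) auto
    have types: "K \<in> {\<gamma>. simple_closed_curve \<gamma>} // knot_rel" "K' \<in> {\<gamma>. simple_closed_curve \<gamma>} // knot_rel"
      using K by (auto simp: knot_types_def)
    have "simple_closed_curve (\<Gamma> ` {0..<L})" "simple_closed_curve (\<Delta> ` {0..<L})"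
      using in_quotient_imp_subset[OF equiv_knot_rel types(1)] in_quotient_imp_subset[OF equiv_knot_rel types(2)]
        \<Gamma>(2) \<Delta>(2) by auto
    then have "(\<Gamma> ` {0..<L}, \<Delta> ` {0..<L}) \<in> knot_rel" using iso by (simp add: knot_rel_def)
    then show "K = K'" using quotient_eqI[OF equiv_knot_rel types \<Gamma>(2) \<Delta>(2)] by simp
  qed
  moreover have "code ` ?S \<subseteq> {..<n} \<rightarrow>\<^sub>E F" using code unfolding coded_def by blast
  moreover have "finite ({..<n} \<rightarrow>\<^sub>E F)" using F(1) by (intro finite_PiE) auto
  ultimately show ?thesis using inj_on_finite by blast
qed (metis finite.emptyI)

theorem proposition5p2:
  fixes q E L :: real
  assumes "q > 2" and "E > 0" and "L > 0"
  shows "finite {K \<in> knot_types. \<exists>\<gamma>\<in>K. \<exists>\<Gamma>.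
           rectifiable_simple_closed_curve \<gamma> \<and> arclength_parametrization L \<Gamma> \<gamma> \<and>
           tangent_point_energy q L \<Gamma> < ennreal E \<and> hausdorff1 \<gamma> = ennreal L}"
proof (rule finite_subset[OF _ finite_aligned_loop_knot_types])
  let ?C = "(32 * E * 32 powr q) powr (1 / (q + 2))" and ?\<alpha> = "(q - 2) / (q + 2)"
  show "0 < L" "0 < ?C" "0 < ?\<alpha>" using assms by auto
  show "{K \<in> knot_types. \<exists>\<gamma>\<in>K. \<exists>\<Gamma>.
           rectifiable_simple_closed_curve \<gamma> \<and> arclength_parametrization L \<Gamma> \<gamma> \<and>
           tangent_point_energy q L \<Gamma> < ennreal E \<and> hausdorff1 \<gamma> = ennreal L}
    \<subseteq> {K \<in> knot_types. \<exists>\<Gamma>. aligned_loop L \<Gamma> ?C ?\<alpha> \<and> \<Gamma> ` {0..<L} \<in> K}"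
  proof (intro Collect_mono impI)
    fix K
    assume "K \<in> knot_types \<and> (\<exists>\<gamma>\<in>K. \<exists>\<Gamma>.
           rectifiable_simple_closed_curve \<gamma> \<and> arclength_parametrization L \<Gamma> \<gamma> \<and>
           tangent_point_energy q L \<Gamma> < ennreal E \<and> hausdorff1 \<gamma> = ennreal L)"
    then obtain \<gamma> \<Gamma> where K: "K \<in> knot_types" "\<gamma> \<in> K" and \<Gamma>: "arclength_parametrization L \<Gamma> \<gamma>"
      and energy: "tangent_point_energy q L \<Gamma> \<le> ennreal E"
      by (auto intro: less_imp_le)
    interpret unit_speed_loop L \<Gamma>
      using \<Gamma> \<open>L > 0\<close> by unfold_locales (auto simp: arclength_parametrization_def)
    have "aligned_loop L \<Gamma> ?C ?\<alpha>"
      by (rule aligned_loop_if_energy_le) (use assms energy in auto)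
    moreover have "\<Gamma> ` {0..<L} \<in> K"
      using \<Gamma> K by (simp add: arclength_parametrization_def)
    ultimately show "K \<in> knot_types \<and> (\<exists>\<Gamma>. aligned_loop L \<Gamma> ?C ?\<alpha> \<and> \<Gamma> ` {0..<L} \<in> K)"
      using K by blast
  qed
qed

end
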